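(* Let $n\ge3$, let $M$ be an oriented, connected, closed topological $n$-manifold, and let $f\colon M\to M$ be a Thurston-type map. Then there exists a sequence $\{D_m\}_{m\in\mathbb N_0}$ of cell decompositions of $M$ such that $f$ is $(D_{m+1},D_m)$-cellular for each $m\in\mathbb N_0$.
   Context: Branched covers. A branched cover is a continuous map that is open and discrete (each fiber is a discrete set). For a branched cover $f\colon X\to X$, the branch set is $B_f=\{x: f$ is not a local homeomorphism at $x\}$ and the postcritical set is $P_f=\bigcup_{m\ge1}f^m(B_f)$. For $A\subseteq X$ put $N(f,A)=\sup\{\operatorname{card}(f^{-1}(y)\cap A): y\in f(A)\}$; the local index is $i(x,f)=\inf\{N(f,U): U$ an open neighborhood of $x\}$. Cells. In a locally compact Hausdorff space $X$, a $k$-dimensional cell ($k\ge1$) is a subset $c$ homeomorphic to $[0,1]^k$; its cell-boundary $\partial_\circ c$ is the set corresponding to $[0,1]^k\setminus(0,1)^k$ and its cell-interior is $\operatorname{int}_\circ c=c\setminus\partial_\circ c$. A $0$-dimensional cell is a singleton $c$, with $\partial_\circ c=\emptyset$, $\operatorname{int}_\circ c=c$. A cell decomposition of $X$ is a collection $D$ of cells such that: the union of all cells is $X$; distinct cells have disjoint cell-interiors; for each $c\in D$, $\partial_\circ c$ is a union of cells in $D$; every point has a neighborhood meeting only finitely many cells of $D$. A cell decomposition $D_1$ of $X$ is a refinement of a cell decomposition $D_0$ of $X$ if each cell of $D_1$ is contained in a cell of $D_0$ and each cell of $D_0$ is the union of the cells of $D_1$ contained in it. Given cell decompositions $D'$ of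 $X'$ and $D$ of $X$, a continuous map $f\colon X'\to X$ is $(D',D)$-cellular if for each $c\in D'$ we have $f(c)\in D$ and $f|_c\colon c\to f(c)$ is a homeomorphism. Thurston-type maps. A branched cover $f\colon M\to M$ on an oriented, connected, closed topological $n$-manifold is cellularly-postcritically-finite (CPCF) if there is a cell decomposition $P$ of $P_f$ such that: (a) there are a refinement $P_0$ of $P$ for which $f|_{P_f}\colon P_f\to P_f$ is $(P_0,P)$-cellular, and a cell decomposition $D_0$ of $M$ with $P_0\subseteq D_0$; (b) there is a cell decomposition $B$ of $B_f$ such that $f|_{B_f}\colon B_f\to P_f$ is $(B,P)$-cellular and, for each $c\in B$, the function $i(\cdot,f)$ is constant on $\operatorname{int}_\circ c$. A Thurston-type map is a CPCF branched cover of topological degree at least $2$. *)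

theory Defs
  imports "HOL-Analysis.Analysis" "HOL-Homology.Homology" "HOL-Library.Extended_Nat"
begin

section \<open>Closed oriented topological manifolds and the topological degree\<close>

definition topological_manifold :: "nat \<Rightarrow> 'a topology \<Rightarrow> bool" where
  "topological_manifold n M \<longleftrightarrow>
     Hausdorff_space M \<and> second_countable M \<and>
     (\<forall>x\<in>topspace M. \<exists>U V. openin M U \<and> x \<in> U \<and> openin (Euclidean_space n) V \<and>
        subtopology M U homeomorphic_space subtopology (Euclidean_space n) V)"

definition closed_manifold :: "nat \<Rightarrow> 'a topology \<Rightarrow> bool" where
  "closed_manifold n M \<longleftrightarrow> topological_manifold n M \<and> compact_space M"

text \<open>An orientation \<open>\<omega>\<close> chooses at each point \<open>x\<close> a generator of the local homology group
  \<open>H\<^sub>n(M, M - {x})\<close>, such that locally the choices are restrictions of a single class in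
  \<open>H\<^sub>n(M, M - U)\<close>.\<close>

definition orientation :: "nat \<Rightarrow> 'a topology \<Rightarrow> ('a \<Rightarrow> 'a chain set) \<Rightarrow> bool" where
  "orientation n M \<omega> \<longleftrightarrow>
     (\<forall>x\<in>topspace M.
        let G = relative_homology_group (int n) M (topspace M - {x})
        in \<omega> x \<in> carrier G \<and> subgroup_generated G {\<omega> x} = G) \<and>
     (\<forall>x\<in>topspace M. \<exists>U. openin M U \<and> x \<in> U \<and>
        (\<exists>\<beta>\<in>carrier (relative_homology_group (int n) M (topspace M - U)).
           \<forall>y\<in>U. hom_induced (int n) M (topspace M - U) M (topspace M - {y}) id \<beta> = \<omega> y))"

definition fundamental_class :: "nat \<Rightarrow> 'a topology \<Rightarrow> ('a \<Rightarrow> 'a chain set) \<Rightarrow> 'a chain set" where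
  "fundamental_class n M \<omega> =
     (THE \<mu>. \<mu> \<in> carrier (homology_group (int n) M) \<and>
        (\<forall>x\<in>topspace M. hom_induced (int n) M {} M (topspace M - {x}) id \<mu> = \<omega> x))"

text \<open>The integer \<open>d\<close> with \<open>f\<^sub>*[M] = d \<sqdot> [M]\<close>; homology groups are written multiplicatively in the
  library.\<close>

definition topological_degree ::
    "nat \<Rightarrow> 'a topology \<Rightarrow> ('a \<Rightarrow> 'a chain set) \<Rightarrow> ('a \<Rightarrow> 'a) \<Rightarrow> int" where
  "topological_degree n M \<omega> f =
     (THE d::int. hom_induced (int n) M {} M {} f (fundamental_class n M \<omega>)
        = fundamental_class n M \<omega> [^]\<^bsub>homology_group (int n) M\<^esub> d)"

section \<open>Branched covers\<close>

definition branched_cover :: "'a topology \<Rightarrow> 'b topology \<Rightarrow> ('a \<Rightarrow> 'b) \<Rightarrow> bool" where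
  "branched_cover X Y f \<longleftrightarrow>
     continuous_map X Y f \<and> open_map X Y f \<and>
     (\<forall>y\<in>topspace Y. let F = {x \<in> topspace X. f x = y} in subtopology X F = discrete_topology F)"

definition local_homeomorphism_at :: "'a topology \<Rightarrow> 'b topology \<Rightarrow> ('a \<Rightarrow> 'b) \<Rightarrow> 'a \<Rightarrow> bool" where
  "local_homeomorphism_at X Y f x \<longleftrightarrow>
     (\<exists>U. openin X U \<and> x \<in> U \<and> openin Y (f ` U) \<and>
        homeomorphic_map (subtopology X U) (subtopology Y (f ` U)) f)"

definition branch_set :: "'a topology \<Rightarrow> ('a \<Rightarrow> 'a) \<Rightarrow> 'a set" where
  "branch_set X f = {x \<in> topspace X. \<not> local_homeomorphism_at X X f x}"

definition postcritical_set :: "'a topology \<Rightarrow> ('a \<Rightarrow> 'a) \<Rightarrow> 'a set" where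
  "postcritical_set X f = (\<Union>m\<in>{1..}. (f ^^ m) ` branch_set X f)"

definition ecard :: "'a set \<Rightarrow> enat" where
  "ecard A = (if finite A then enat (card A) else \<infinity>)"

definition max_multiplicity :: "('a \<Rightarrow> 'b) \<Rightarrow> 'a set \<Rightarrow> enat" where
  "max_multiplicity f A = (SUP y\<in>f ` A. ecard (f -` {y} \<inter> A))"

definition local_index :: "'a topology \<Rightarrow> ('a \<Rightarrow> 'b) \<Rightarrow> 'a \<Rightarrow> enat" where
  "local_index X f x = (INF U\<in>{U. openin X U \<and> x \<in> U}. max_multiplicity f U)"

section \<open>Cells and cell decompositions\<close>

text \<open>Points of \<open>\<real>\<^sup>k\<close> are sequences vanishing from index \<open>k\<close> on. Both cubes are the singleton of the
  zero sequence for \<open>k = 0\<close>, so the definitions below yield the convention that 0-dimensional cells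
  are singletons with empty cell-boundary.\<close>

definition unit_cube :: "nat \<Rightarrow> (nat \<Rightarrow> real) set" where
  "unit_cube k = {x \<in> topspace (Euclidean_space k). \<forall>i<k. 0 \<le> x i \<and> x i \<le> 1}"

definition open_unit_cube :: "nat \<Rightarrow> (nat \<Rightarrow> real) set" where
  "open_unit_cube k = {x \<in> topspace (Euclidean_space k). \<forall>i<k. 0 < x i \<and> x i < 1}"

definition cell_chart :: "'a topology \<Rightarrow> nat \<Rightarrow> 'a set \<Rightarrow> ('a \<Rightarrow> nat \<Rightarrow> real) \<Rightarrow> bool" where
  "cell_chart X k c h \<longleftrightarrow>
     homeomorphic_map (subtopology X c) (subtopology (Euclidean_space k) (unit_cube k)) h"

definition is_cell :: "'a topology \<Rightarrow> 'a set \<Rightarrow> bool" where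
  "is_cell X c \<longleftrightarrow> c \<subseteq> topspace X \<and> (\<exists>k h. cell_chart X k c h)"

text \<open>By invariance of domain, the dimension \<open>k\<close> and the set of points corresponding to the boundary
  of the cube do not depend on the chart.\<close>

definition cell_boundary :: "'a topology \<Rightarrow> 'a set \<Rightarrow> 'a set" where
  "cell_boundary X c = {x \<in> c. \<exists>k h. cell_chart X k c h \<and> h x \<in> unit_cube k - open_unit_cube k}"

definition cell_interior :: "'a topology \<Rightarrow> 'a set \<Rightarrow> 'a set" where
  "cell_interior X c = c - cell_boundary X c"

definition cell_decomposition :: "'a topology \<Rightarrow> 'a set set \<Rightarrow> bool" where
  "cell_decomposition X D \<longleftrightarrow>
     (\<forall>c\<in>D. is_cell X c) \<and>
     \<Union>D = topspace X \<and>
     (\<forall>c\<in>D. \<forall>c'\<in>D. c \<noteq> c' \<longrightarrow> cell_interior X c \<inter> cell_interior X c' = {}) \<and>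
     (\<forall>c\<in>D. \<exists>S\<subseteq>D. cell_boundary X c = \<Union>S) \<and>
     (\<forall>x\<in>topspace X. \<exists>U. openin X U \<and> x \<in> U \<and> finite {c\<in>D. c \<inter> U \<noteq> {}})"

definition cell_refinement :: "'a topology \<Rightarrow> 'a set set \<Rightarrow> 'a set set \<Rightarrow> bool" where
  "cell_refinement X D\<^sub>1 D\<^sub>0 \<longleftrightarrow>
     cell_decomposition X D\<^sub>1 \<and> cell_decomposition X D\<^sub>0 \<and>
     (\<forall>c\<in>D\<^sub>1. \<exists>c'\<in>D\<^sub>0. c \<subseteq> c') \<and>
     (\<forall>c'\<in>D\<^sub>0. c' = \<Union>{c\<in>D\<^sub>1. c \<subseteq> c'})"

definition cellular ::
    "'a topology \<Rightarrow> 'b topology \<Rightarrow> 'a set set \<Rightarrow> 'b set set \<Rightarrow> ('a \<Rightarrow> 'b) \<Rightarrow> bool" where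
  "cellular X' X D' D f \<longleftrightarrow>
     cell_decomposition X' D' \<and> cell_decomposition X D \<and> continuous_map X' X f \<and>
     (\<forall>c\<in>D'. f ` c \<in> D \<and> homeomorphic_map (subtopology X' c) (subtopology X (f ` c)) f)"

section \<open>Thurston-type maps\<close>

definition CPCF :: "'a topology \<Rightarrow> ('a \<Rightarrow> 'a) \<Rightarrow> bool" where
  "CPCF M f \<longleftrightarrow>
     branched_cover M M f \<and>
     (let B_f = branch_set M f; P_f = postcritical_set M f;
          X_B = subtopology M B_f; X_P = subtopology M P_f
      in \<exists>P. cell_decomposition X_P P \<and>
           (\<exists>P\<^sub>0 D\<^sub>0. cell_refinement X_P P\<^sub>0 P \<and> cellular X_P X_P P\<^sub>0 P f \<and>
              cell_decomposition M D\<^sub>0 \<and> P\<^sub>0 \<subseteq> D\<^sub>0) \<and>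
           (\<exists>B. cell_decomposition X_B B \<and> cellular X_B X_P B P f \<and>
              (\<forall>c\<in>B. \<forall>x\<in>cell_interior X_B c. \<forall>y\<in>cell_interior X_B c.
                 local_index M f x = local_index M f y)))"

definition Thurston_type_map ::
    "nat \<Rightarrow> 'a topology \<Rightarrow> ('a \<Rightarrow> 'a chain set) \<Rightarrow> ('a \<Rightarrow> 'a) \<Rightarrow> bool" where
  "Thurston_type_map n M \<omega> f \<longleftrightarrow> CPCF M f \<and> topological_degree n M \<omega> f \<ge> 2"

end

theory Submission
  imports Defs
begin

text \<open>
  Pull back a cell decomposition \<open>D\<close> by taking as new cells all sets that \<open>f\<close> maps homeomorphically
  onto a cell of \<open>D\<close>. This is again a cell decomposition as soon as \<open>f\<close> is locally injective over the
  interior of every cell \<open>c\<close> of \<open>D\<close>: a section over a small cube concentric with a given point of the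
  interior can be enlarged step by step, since \<open>f\<close> is open and injective near the compact image of the
  section, and it extends to the boundary, since the fibres are finite and the open cube is locally
  connected at its boundary.

  Local injectivity is clear over cells missing the postcritical set. Over the interior of a cell \<open>p\<close>
  of \<open>P\<close> it comes from the constancy of the local index on each branch cell \<open>b\<close> over \<open>p\<close>: near \<open>b\<close>
  a second preimage of a point of \<open>p\<close> would give a nearby value with more than \<open>i(b, f)\<close> preimages.
  This needs finite local indices. By the Baire category theorem \<open>f(B\<^sub>f)\<close> has empty interior, the
  cardinality of the fibre is constant on each of the finitely many open cells of \<open>D\<^sub>0\<close> outside
  \<open>f(B\<^sub>f)\<close>, and it is lower semicontinuous, hence it is bounded.

  That every open cell either misses \<open>P\<^sub>f\<close> or lies in an open cell of \<open>P\<close> holds for \<open>D\<^sub>0\<close> and is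
  inherited by pull-backs, so the pull-back can be iterated.
\<close>

section \<open>Cubes and invariance of domain\<close>

text \<open>Covering theory does not apply directly: the preimage of an open cell may run inside the
  branch set, where \<open>f\<close> is not a local homeomorphism of \<open>M\<close>. What survives
  is weaker and suffices: \<open>f\<close> is open on all of \<open>M\<close>, and two nearby points
  over the same point of the open cell coincide. Openness makes local sections continuous,
  injectivity makes them unique.

  The two halves of the postcritical hypothesis do different jobs. The decomposition of the branch
  set yields local injectivity over the open cells of \<open>P\<close>. The cellularity of
  \<open>f\<close> from \<open>P\<^sub>0\<close> to \<open>P\<close> keeps pull-backs compatible
  with \<open>P\<close>: if a lifted open cell meets the postcritical set at \<open>x\<close>, then
  it and the open cell of \<open>P\<^sub>0\<close> through \<open>x\<close> contain sheets over one
  connected set, so they agree there, and the lifted open cell stays in an open cell of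
  \<open>P\<^sub>0\<close>, hence of \<open>P\<close>.

  Local indices are extended naturals. The counting argument gains exactly one sheet, which
  contradicts nothing when the constant index is infinite; this is why a uniform bound on the fibres
  has to be found first.\<close>

primrec gauge_max :: "(nat \<Rightarrow> real \<Rightarrow> real) \<Rightarrow> nat \<Rightarrow> (nat \<Rightarrow> real) \<Rightarrow> real" where
  "gauge_max \<phi> 0 q = 0"
| "gauge_max \<phi> (Suc k) q = max (gauge_max \<phi> k q) (\<phi> k (q k))"

text \<open>The recursion starts from 0, so the gauge is defined in dimension 0 as well; this is
  also the reason for the sign condition on \<open>t\<close>.\<close>

lemma gauge_max_le_iff: "0 \<le> t \<Longrightarrow> gauge_max \<phi> k q \<le> t \<longleftrightarrow> (\<forall>i<k. \<phi> i (q i) \<le> t)"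
  by (induction k) (auto simp: less_Suc_eq)

lemma gauge_max_less_iff: "0 < t \<Longrightarrow> gauge_max \<phi> k q < t \<longleftrightarrow> (\<forall>i<k. \<phi> i (q i) < t)"
  by (induction k) (auto simp: less_Suc_eq)

lemma gauge_max_nonneg: "0 \<le> gauge_max \<phi> k q"
  by (induction k) (auto simp: max_def)

lemma gauge_max_ge: "i < k \<Longrightarrow> \<phi> i (q i) \<le> gauge_max \<phi> k q"
  by (induction k) (auto simp: less_Suc_eq)

lemma continuous_map_Euclidean_space_component:
  "continuous_map (Euclidean_space n) euclideanreal (\<lambda>x. x i)"
  unfolding Euclidean_space_def
  by (intro continuous_map_from_subtopology continuous_map_product_projection) simp

lemma continuous_map_gauge_max:
  assumes "\<And>i. continuous_on UNIV (\<phi> i)"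
  shows "continuous_map (Euclidean_space n) euclideanreal (gauge_max \<phi> k)"
proof (induction k)
  case (Suc k)
  have "continuous_map euclideanreal euclideanreal (\<phi> k)"
    using assms by simp
  then have "continuous_map (Euclidean_space n) euclideanreal (\<phi> k \<circ> (\<lambda>x. x k))"
    using continuous_map_Euclidean_space_component continuous_map_compose by blast
  then show ?case
    using continuous_map_real_max[OF Suc.IH] by (simp add: comp_def)
qed simp

section \<open>Segments and convex sets in coordinate space\<close>

definition seg :: "real \<Rightarrow> (nat \<Rightarrow> real) \<Rightarrow> (nat \<Rightarrow> real) \<Rightarrow> nat \<Rightarrow> real" where
  "seg u a b = (\<lambda>i. (1 - u) * a i + u * b i)"

lemma seg_endpoints [simp]: "seg 0 a b = a" "seg 1 a b = b"
  by (simp_all add: seg_def)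

lemma continuous_map_seg:
  assumes "a \<in> topspace (Euclidean_space k)" "b \<in> topspace (Euclidean_space k)"
  shows "continuous_map euclideanreal (Euclidean_space k) (\<lambda>u. seg u a b)"
proof -
  have "continuous_map euclideanreal (Euclidean_space k)
          (\<lambda>u i. if i < k then (1 - u) * a i + u * b i else 0)"
    by (subst continuous_map_componentwise_Euclidean_space) (auto intro!: continuous_intros)
  moreover have "(\<lambda>u i. if i < k then (1 - u) * a i + u * b i else 0) = (\<lambda>u. seg u a b)"
    using assms by (auto simp: seg_def topspace_Euclidean_space fun_eq_iff)
  ultimately show ?thesis by simp
qed

lemma connectedin_seg_convex:
  assumes S: "S \<subseteq> topspace (Euclidean_space k)"
    and conv: "\<And>a b u. \<lbrakk>a \<in> S; b \<in> S; 0 \<le> u; u \<le> 1\<rbrakk> \<Longrightarrow> seg u a b \<in> S"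
  shows "connectedin (Euclidean_space k) S"
proof -
  have "path_connectedin (Euclidean_space k) S"
    unfolding path_connectedin
  proof (intro conjI ballI S)
    fix a b assume ab: "a \<in> S" "b \<in> S"
    show "\<exists>g. pathin (Euclidean_space k) g \<and> g \<in> {0..1} \<rightarrow> S \<and> g 0 = a \<and> g 1 = b"
    proof (intro exI conjI)
      show "pathin (Euclidean_space k) (\<lambda>u. seg u a b)"
        unfolding pathin_def using ab S
        by (intro continuous_map_from_subtopology continuous_map_seg) auto
    qed (use ab conv in auto)
  qed
  then show ?thesis by (rule path_connectedin_imp_connectedin)
qed

lemma seg_mem_Euclidean_space:
  "\<lbrakk>a \<in> topspace (Euclidean_space k); b \<in> topspace (Euclidean_space k)\<rbrakk>
    \<Longrightarrow> seg u a b \<in> topspace (Euclidean_space k)"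
  by (simp add: topspace_Euclidean_space seg_def)

section \<open>Topology of the closed and open cubes\<close>

lemma unit_cube_subset: "unit_cube k \<subseteq> topspace (Euclidean_space k)"
  and open_unit_cube_subset: "open_unit_cube k \<subseteq> unit_cube k"
  by (auto simp: unit_cube_def open_unit_cube_def less_imp_le)

lemma compactin_unit_cube: "compactin (Euclidean_space k) (unit_cube k)"
proof -
  \<comment> \<open>Confining the coordinates from \<open>k\<close> on to {0} turns the cube into a
    full product of compact sets, so that Tychonoff's theorem applies.\<close>
  have "unit_cube k = (\<Pi>\<^sub>E i\<in>UNIV. if i < k then {0..1} else {0::real})"
    by (auto simp: unit_cube_def topspace_Euclidean_space PiE_iff split: if_splits)
  moreover have "compactin (powertop_real UNIV) (\<Pi>\<^sub>E i\<in>UNIV. if i < k then {0..1} else {0::real})"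
    by (auto simp: compactin_PiE)
  ultimately show ?thesis
    unfolding Euclidean_space_def
    by (auto simp: compactin_subtopology unit_cube_def topspace_Euclidean_space)
qed

lemma openin_open_unit_cube: "openin (Euclidean_space k) (open_unit_cube k)"
proof -
  \<comment> \<open>For real s, |2s - 1| < 1 says 0 < s < 1, which makes the open cube a strict
    sublevel set of one gauge.\<close>
  let ?\<phi> = "\<lambda>i s. \<bar>2 * s - 1\<bar> :: real"
  have "open_unit_cube k = {x \<in> topspace (Euclidean_space k). gauge_max ?\<phi> k x \<in> {..<1}}"
    by (auto simp: open_unit_cube_def gauge_max_less_iff abs_less_iff)
  moreover have "continuous_map (Euclidean_space k) euclideanreal (gauge_max ?\<phi> k)"
    by (intro continuous_map_gauge_max continuous_intros)
  ultimately show ?thesis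
    using openin_continuous_map_preimage[of "Euclidean_space k" euclideanreal _ "{..<1}"] by simp
qed

lemma openin_Euclidean_space_coordinate:
  assumes U: "openin (Euclidean_space k) U" and x: "x \<in> U" and i: "i < k"
  obtains e where "e > 0" "\<And>s. \<bar>s - x i\<bar> < e \<Longrightarrow> x(i := s) \<in> U"
proof -
  have xE: "x \<in> topspace (Euclidean_space k)"
    using U x openin_subset by blast
  have "continuous_map euclideanreal (Euclidean_space k)
          (\<lambda>s j. if j < k then (if j = i then s else x j) else 0)"
    by (subst continuous_map_componentwise_Euclidean_space) (auto intro!: continuous_intros)
  moreover have "(\<lambda>s j. if j < k then (if j = i then s else x j) else 0) = (\<lambda>s. x(i := s))"
    using xE i by (auto simp: fun_eq_iff topspace_Euclidean_space)
  ultimately have "continuous_map euclideanreal (Euclidean_space k) (\<lambda>s. x(i := s))"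
    by simp
  then have "open {s. x(i := s) \<in> U}"
    using openin_continuous_map_preimage[OF _ U] by fastforce
  then obtain e where "e > 0" "\<And>s. dist s (x i) < e \<Longrightarrow> x(i := s) \<in> U"
    using x unfolding open_dist by (metis fun_upd_triv mem_Collect_eq)
  then show thesis
    using that by (simp add: dist_real_def)
qed

text \<open>A coordinate of a point of an open set can be moved a little in both directions without
  leaving the set, hence without leaving the closed cube, so it is neither 0 nor 1.\<close>

lemma openin_subset_open_unit_cube:
  assumes U: "openin (Euclidean_space k) U" and sub: "U \<subseteq> unit_cube k"
  shows "U \<subseteq> open_unit_cube k"
proof
  fix x assume x: "x \<in> U"
  have "0 < x i \<and> x i < 1" if i: "i < k" for i
  proof -
    obtain e where e: "e > 0" "\<And>s. \<bar>s - x i\<bar> < e \<Longrightarrow> x(i := s) \<in> U"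
      using openin_Euclidean_space_coordinate[OF U x i] by blast
    have "x(i := x i - e/2) \<in> U" "x(i := x i + e/2) \<in> U"
      using e(1) by (intro e(2); simp)+
    then have "x(i := x i - e/2) \<in> unit_cube k" "x(i := x i + e/2) \<in> unit_cube k"
      using sub by blast+
    then show ?thesis
      using i e(1) by (auto simp: unit_cube_def dest!: spec[of _ i])
  qed
  then show "x \<in> open_unit_cube k"
    using x sub by (auto simp: open_unit_cube_def unit_cube_def)
qed

lemma open_unit_cube_nonempty: "(\<lambda>i. if i < k then 1/2 else 0) \<in> open_unit_cube k"
  by (simp add: open_unit_cube_def topspace_Euclidean_space)

text \<open>Invariance of domain with a free target dimension \<open>m\<close>: the choice
  \<open>m = k\<close> rules out j < k, and \<open>m = j\<close> is used once the dimensions are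
  known to agree.\<close>

lemma cube_homeo_open_image:
  assumes g: "homeomorphic_map (subtopology (Euclidean_space k) (unit_cube k))
                (subtopology (Euclidean_space j) (unit_cube j)) g"
    and jm: "j \<le> m" and mk: "m \<le> k"
  shows "openin (Euclidean_space m) (g ` open_unit_cube k)"
proof (rule invariance_of_domain_Euclidean_space_gen[OF mk openin_open_unit_cube])
  have Ej: "Euclidean_space j = subtopology (Euclidean_space m) (topspace (Euclidean_space j))"
    by (metis Euclidean_space_def jm inf.absorb_iff2 subset_Euclidean_space
        subtopology_subtopology topspace_Euclidean_space)
  have "continuous_map (subtopology (Euclidean_space k) (unit_cube k)) (Euclidean_space j) g"
    using g continuous_map_in_subtopology homeomorphic_imp_continuous_map by blast
  then have "continuous_map (subtopology (Euclidean_space k) (unit_cube k)) (Euclidean_space m) g"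
    by (metis Ej continuous_map_in_subtopology)
  then show "continuous_map (subtopology (Euclidean_space k) (open_unit_cube k)) (Euclidean_space m) g"
    by (meson continuous_map_from_subtopology_mono open_unit_cube_subset)
  have "inj_on g (unit_cube k)"
    using homeomorphic_imp_injective_map[OF g] unit_cube_subset by (simp add: inf_absorb2)
  then show "inj_on g (open_unit_cube k)"
    by (meson inj_on_subset open_unit_cube_subset)
qed

lemma cube_homeo_image_subset:
  assumes g: "homeomorphic_map (subtopology (Euclidean_space k) (unit_cube k))
                (subtopology (Euclidean_space j) (unit_cube j)) g"
  shows "g ` open_unit_cube k \<subseteq> unit_cube j"
proof -
  have "g ` unit_cube k = unit_cube j"
    using homeomorphic_imp_surjective_map[OF g] unit_cube_subset by (simp add: inf_absorb2)
  then show ?thesis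
    using open_unit_cube_subset by blast
qed

text \<open>If j < k, the image of the open cube would be open in k-space although its coordinate
  with index \<open>j\<close> vanishes identically; perturbing that coordinate is a
  contradiction.\<close>

lemma cube_homeo_dim_le:
  assumes g: "homeomorphic_map (subtopology (Euclidean_space k) (unit_cube k))
                (subtopology (Euclidean_space j) (unit_cube j)) g"
  shows "k \<le> j"
proof (rule ccontr)
  assume "\<not> k \<le> j"
  then have jk: "j < k" by simp
  let ?c = "\<lambda>i. if i < k then 1/2 else (0::real)"
  have gc: "g ?c \<in> g ` open_unit_cube k"
    using open_unit_cube_nonempty by blast
  have "openin (Euclidean_space k) (g ` open_unit_cube k)"
    using cube_homeo_open_image[OF g, of k] jk by simp
  then obtain e where "e > 0" "\<And>s. \<bar>s - g ?c j\<bar> < e \<Longrightarrow> (g ?c)(j := s) \<in> g ` open_unit_cube k"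
    using openin_Euclidean_space_coordinate[OF _ gc jk] by blast
  then have "(g ?c)(j := g ?c j + e/2) \<in> g ` open_unit_cube k" and e: "e > 0"
    by simp_all
  then have "(g ?c)(j := g ?c j + e/2) \<in> unit_cube j" and "g ?c \<in> unit_cube j"
    using cube_homeo_image_subset[OF g] gc by blast+
  then have "((g ?c)(j := g ?c j + e/2)) j = 0" "g ?c j = 0"
    unfolding unit_cube_def topspace_Euclidean_space by blast+
  then show False
    using e by simp
qed

lemma cube_homeo_open_unit_cube:
  assumes g: "homeomorphic_map (subtopology (Euclidean_space k) (unit_cube k))
                (subtopology (Euclidean_space j) (unit_cube j)) g"
    and x: "x \<in> open_unit_cube k"
  shows "g x \<in> open_unit_cube j"
proof -
  obtain g' where "homeomorphic_map (subtopology (Euclidean_space j) (unit_cube j))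
                (subtopology (Euclidean_space k) (unit_cube k)) g'"
    using homeomorphic_maps_map[THEN iffD1] homeomorphic_map_maps[THEN iffD1, OF g] by blast
  then have "j = k"
    using g cube_homeo_dim_le by (metis le_antisym)
  then have "openin (Euclidean_space j) (g ` open_unit_cube k)"
    using cube_homeo_open_image[OF g, of j] by simp
  then show ?thesis
    using openin_subset_open_unit_cube cube_homeo_image_subset[OF g] x by blast
qed

text \<open>The transition between two charts is a homeomorphism of cubes and so preserves open
  cubes. This lets \<open>cell_boundary\<close>, which quantifies over all charts, be computed in
  any single one.\<close>

lemma cell_chart_transition:
  assumes h: "cell_chart X k c h" and h': "cell_chart X j c h'" and c: "c \<subseteq> topspace X"
    and x: "x \<in> c" "h x \<in> open_unit_cube k"
  shows "h' x \<in> open_unit_cube j"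
proof -
  obtain g where g: "homeomorphic_maps (subtopology X c)
        (subtopology (Euclidean_space k) (unit_cube k)) h g"
    using h unfolding cell_chart_def homeomorphic_map_maps by blast
  then have "homeomorphic_map (subtopology (Euclidean_space k) (unit_cube k))
      (subtopology (Euclidean_space j) (unit_cube j)) (h' \<circ> g)"
    using h' unfolding cell_chart_def homeomorphic_maps_map
    by (auto intro: homeomorphic_map_compose)
  then have "h' (g (h x)) \<in> open_unit_cube j"
    using cube_homeo_open_unit_cube x by fastforce
  moreover have "g (h x) = x"
    using g x c by (auto simp: homeomorphic_maps_def)
  ultimately show ?thesis by simp
qed

lemma cell_chart_image:
  assumes "cell_chart X k c h" "c \<subseteq> topspace X"
  shows "h ` c = unit_cube k"
  using assms unit_cube_subset unfolding cell_chart_def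
  by (metis homeomorphic_imp_surjective_map inf_absorb2 topspace_subtopology)

lemma cell_interior_chart:
  assumes h: "cell_chart X k c h" and c: "c \<subseteq> topspace X"
  shows "cell_interior X c = {x \<in> c. h x \<in> open_unit_cube k}"
proof -
  have "cell_boundary X c = {x \<in> c. h x \<notin> open_unit_cube k}"
  proof (intro equalityI subsetI)
    fix x assume "x \<in> cell_boundary X c"
    then obtain j h' where "x \<in> c" "cell_chart X j c h'" "h' x \<notin> open_unit_cube j"
      by (auto simp: cell_boundary_def)
    then show "x \<in> {x \<in> c. h x \<notin> open_unit_cube k}"
      using cell_chart_transition[OF h _ c] by blast
  next
    fix x assume "x \<in> {x \<in> c. h x \<notin> open_unit_cube k}"
    then show "x \<in> cell_boundary X c"
      using h cell_chart_image[OF h c] unfolding cell_boundary_def by blast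
  qed
  then show ?thesis by (auto simp: cell_interior_def)
qed

section \<open>Star-shaped gauges on cubes\<close>

text \<open>What lifting uses of a cube with a marked interior point, free of coordinates. Connected
  sublevels give uniqueness of lifts, \<open>closure_sublevel\<close> makes an open sublevel dense
  in the closed one, and \<open>locally_connected_sublevel\<close>, applied at frontier points,
  gives a lift a single limit there.\<close>

locale star_gauge =
  fixes T :: "'b topology" and a :: 'b and \<rho> :: "'b \<Rightarrow> real"
  assumes compact_T: "compact_space T"
    and continuous_\<rho>: "continuous_map T euclideanreal \<rho>"
    and center: "a \<in> topspace T"
    and \<rho>_nonneg: "q \<in> topspace T \<Longrightarrow> 0 \<le> \<rho> q"
    and \<rho>_le_1: "q \<in> topspace T \<Longrightarrow> \<rho> q \<le> 1"
    and \<rho>_eq_0: "q \<in> topspace T \<Longrightarrow> \<rho> q = 0 \<longleftrightarrow> q = a"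
    and connectedin_sublevel: "0 < t \<Longrightarrow> connectedin T {q \<in> topspace T. \<rho> q < t}"
    and closure_sublevel:
      "\<lbrakk>0 < t; q \<in> topspace T; \<rho> q \<le> t\<rbrakk> \<Longrightarrow> q \<in> T closure_of {q \<in> topspace T. \<rho> q < t}"
    and locally_connected_sublevel:
      "\<lbrakk>0 < t; openin T W; q \<in> W\<rbrakk>
        \<Longrightarrow> \<exists>V. openin T V \<and> q \<in> V \<and> V \<subseteq> W \<and> connectedin T (V \<inter> {q \<in> topspace T. \<rho> q < t})"

text \<open>The centre must be an arbitrary interior point, because a lift is prescribed only over
  the given value \<open>f x\<close>, which can lie anywhere in the open cell.\<close>

lemma cube_star_gauge:
  assumes a: "a \<in> open_unit_cube k"
  obtains \<rho> where "star_gauge (subtopology (Euclidean_space k) (unit_cube k)) a \<rho>"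
    and "\<And>q. q \<in> unit_cube k \<Longrightarrow> \<rho> q < 1 \<longleftrightarrow> q \<in> open_unit_cube k"
proof -
  let ?E = "Euclidean_space k"
  let ?T = "subtopology ?E (unit_cube k)"
  \<comment> \<open>\<open>\<rho>\<close> is the Minkowski gauge of the cube with respect to \<open>a\<close>.\<close>
  define \<phi> :: "nat \<Rightarrow> real \<Rightarrow> real"
    where "\<phi> = (\<lambda>i s. max ((a i - s) * inverse (a i)) ((s - a i) * inverse (1 - a i)))"
  define \<rho> where "\<rho> = gauge_max \<phi> k"
  have a01: "0 < a i" "a i < 1" if "i < k" for i
    using a that by (auto simp: open_unit_cube_def)
  have a_cube: "a \<in> unit_cube k"
    using a open_unit_cube_subset by blast
  have top: "topspace ?T = unit_cube k"
    using unit_cube_subset by (simp add: inf_absorb2)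
  have \<phi>_less: "\<phi> i s < 1 \<longleftrightarrow> 0 < s \<and> s < 1" if "i < k" for i s
    using a01[OF that] by (auto simp: \<phi>_def field_simps)
  have \<phi>_le: "\<phi> i s \<le> 1 \<longleftrightarrow> 0 \<le> s \<and> s \<le> 1" if "i < k" for i s
    using a01[OF that] by (auto simp: \<phi>_def field_simps)
  have \<phi>_0: "\<phi> i s \<le> 0 \<longleftrightarrow> s = a i" if "i < k" for i s
    using a01[OF that] by (auto simp: \<phi>_def field_simps)
  have \<phi>_convex: "\<phi> i ((1 - u) * r + u * s) \<le> (1 - u) * \<phi> i r + u * \<phi> i s"
    if "0 \<le> u" "u \<le> 1" for i u r s
  proof -
    have 1: "(a i - ((1 - u) * r + u * s)) * inverse (a i)
           = (1 - u) * ((a i - r) * inverse (a i)) + u * ((a i - s) * inverse (a i))"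
      by (simp add: algebra_simps)
    have 2: "(((1 - u) * r + u * s) - a i) * inverse (1 - a i)
           = (1 - u) * ((r - a i) * inverse (1 - a i)) + u * ((s - a i) * inverse (1 - a i))"
      by (simp add: algebra_simps)
    show ?thesis
      unfolding \<phi>_def 1 2 using that
      by (intro max.boundedI add_mono mult_left_mono) auto
  qed
  have cont_\<rho>: "continuous_map ?E euclideanreal \<rho>"
    unfolding \<rho>_def \<phi>_def by (intro continuous_map_gauge_max continuous_intros)
  \<comment> \<open>Convexity of \<rho> makes its sublevels convex, hence connected. Since \<rho>
    vanishes at \<open>a\<close>, moving from a point towards \<open>a\<close> by a fraction u
    multiplies the gauge by at most 1 - u.\<close>
  have \<rho>_seg: "\<rho> (seg u v w) \<le> (1 - u) * \<rho> v + u * \<rho> w" if u: "0 \<le> u" "u \<le> 1" for u v w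
  proof -
    have "\<phi> i (seg u v w i) \<le> (1 - u) * \<rho> v + u * \<rho> w" if "i < k" for i
    proof -
      have "\<phi> i (seg u v w i) \<le> (1 - u) * \<phi> i (v i) + u * \<phi> i (w i)"
        unfolding seg_def by (rule \<phi>_convex[OF u])
      also have "\<dots> \<le> (1 - u) * \<rho> v + u * \<rho> w"
        unfolding \<rho>_def using that u by (intro add_mono mult_left_mono gauge_max_ge) auto
      finally show ?thesis .
    qed
    then show ?thesis
      unfolding \<rho>_def using u by (subst gauge_max_le_iff) (auto intro!: add_nonneg_nonneg mult_nonneg_nonneg gauge_max_nonneg)
  qed
  have \<rho>_a: "\<rho> a = 0"
  proof -
    have "\<rho> a \<le> 0"
      unfolding \<rho>_def by (subst gauge_max_le_iff) (auto simp: \<phi>_0)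
    then show ?thesis
      using gauge_max_nonneg[of \<phi> k a] by (simp add: \<rho>_def)
  qed
  have seg_cube: "seg u v w \<in> unit_cube k"
    if "v \<in> unit_cube k" "w \<in> unit_cube k" "0 \<le> u" "u \<le> 1" for u v w
    using that by (auto simp: unit_cube_def seg_mem_Euclidean_space)
      (auto simp: seg_def intro: convex_bound_le)
  have sub_seg: "\<rho> (seg u v w) < t" if "\<rho> v < t" "\<rho> w < t" "0 \<le> u" "u \<le> 1" for u v w t
    using order_le_less_trans[OF \<rho>_seg] convex_bound_lt[of "\<rho> v" t "\<rho> w" "1 - u" u] that by simp
  have less_iff: "\<rho> q < 1 \<longleftrightarrow> q \<in> open_unit_cube k" if "q \<in> unit_cube k" for q
    using that by (auto simp: \<rho>_def gauge_max_less_iff \<phi>_less open_unit_cube_def unit_cube_def)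
  have "star_gauge ?T a \<rho>"
  proof
    show "compact_space ?T"
      using compactin_unit_cube compact_space_subtopology by blast
    show "continuous_map ?T euclideanreal \<rho>"
      by (intro continuous_map_from_subtopology cont_\<rho>)
    show "a \<in> topspace ?T"
      using a_cube top by blast
    fix q assume q: "q \<in> topspace ?T"
    then have qc: "q \<in> unit_cube k" by (simp add: top)
    show "0 \<le> \<rho> q"
      by (simp add: \<rho>_def gauge_max_nonneg)
    show "\<rho> q \<le> 1"
      using qc by (auto simp: \<rho>_def gauge_max_le_iff \<phi>_le unit_cube_def)
    show "\<rho> q = 0 \<longleftrightarrow> q = a"
    proof
      assume "\<rho> q = 0"
      then have "\<forall>i<k. q i = a i"
        using gauge_max_le_iff[of 0 \<phi> k q] \<phi>_0 by (simp add: \<rho>_def)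
      moreover have "\<forall>i\<ge>k. q i = a i"
        using qc a_cube by (simp add: unit_cube_def topspace_Euclidean_space)
      ultimately show "q = a" by (metis ext leI)
    qed (simp add: \<rho>_a)
    fix t :: real assume t: "0 < t" and qt: "\<rho> q \<le> t"
    show "q \<in> ?T closure_of {q \<in> topspace ?T. \<rho> q < t}"
      unfolding in_closure_of
    proof (intro conjI allI impI q)
      fix U assume U: "q \<in> U \<and> openin ?T U"
      then obtain U' where U': "openin ?E U'" "U = U' \<inter> unit_cube k"
        by (auto simp: openin_subtopology)
      have qa: "q \<in> topspace ?E" "a \<in> topspace ?E"
        using qc a_cube unit_cube_subset by blast+
      have "open {u. seg u q a \<in> U'}"
        using openin_continuous_map_preimage[OF continuous_map_seg[OF qa] U'(1)] by simp
      moreover have "0 \<in> {u. seg u q a \<in> U'}"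
        using U U' by simp
      ultimately obtain e where e: "e > 0" "\<And>u. dist u 0 < e \<Longrightarrow> seg u q a \<in> U'"
        unfolding open_dist by blast
      \<comment> \<open>A step towards \<open>a\<close> that is short enough to stay in
        \<open>U'\<close> and still lowers the bound \<open>t\<close> strictly.\<close>
      define u where "u = min (e/2) 1"
      have u: "0 < u" "u \<le> 1" "dist u 0 < e"
        using e(1) by (auto simp: u_def min_def)
      have "\<rho> (seg u q a) \<le> (1 - u) * \<rho> q"
        using \<rho>_seg[of u q a] u by (simp add: \<rho>_a)
      also have "\<dots> \<le> (1 - u) * t"
        using u qt by (intro mult_left_mono) auto
      also have "\<dots> < t"
        using u t by simp
      finally have "\<rho> (seg u q a) < t" .
      moreover have "seg u q a \<in> unit_cube k"
        using seg_cube qc a_cube u by simp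
      ultimately show "\<exists>y. y \<in> {q \<in> topspace ?T. \<rho> q < t} \<and> y \<in> U"
        using e(2)[OF u(3)] U'(2) top by blast
    qed
  next
    fix t :: real assume t: "0 < t"
    show "connectedin ?T {q \<in> topspace ?T. \<rho> q < t}"
      unfolding connectedin_subtopology top
    proof (intro conjI connectedin_seg_convex)
      show "{q \<in> unit_cube k. \<rho> q < t} \<subseteq> topspace ?E"
        using unit_cube_subset by blast
    qed (auto simp: seg_cube sub_seg)
  next
    fix t :: real and W q assume t: "0 < t" and W: "openin ?T W" and q: "q \<in> W"
    have qc: "q \<in> unit_cube k"
      using W q openin_subset top by blast
    \<comment> \<open>Distance from \<open>q\<close> in the maximum norm; its balls are convex
      boxes, so their intersections with sublevels of \<rho> are connected.\<close>
    define \<delta> where "\<delta> = gauge_max (\<lambda>i s. \<bar>s - q i\<bar>) k"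
    have cont_\<delta>: "continuous_map ?T euclideanreal \<delta>"
      unfolding \<delta>_def
      by (intro continuous_map_from_subtopology continuous_map_gauge_max continuous_intros)
    have \<delta>_0: "\<delta> p = 0 \<Longrightarrow> p = q" if p: "p \<in> unit_cube k" for p
    proof -
      assume "\<delta> p = 0"
      then have "\<forall>i<k. p i = q i"
        using gauge_max_le_iff[of 0 "\<lambda>i s. \<bar>s - q i\<bar>" k p] by (simp add: \<delta>_def)
      moreover have "\<forall>i\<ge>k. p i = q i"
        using p qc by (simp add: unit_cube_def topspace_Euclidean_space)
      ultimately show "p = q" by (metis ext leI)
    qed
    \<comment> \<open>On the compact complement of \<open>W\<close> the distance \<delta> takes a
      closed set of values that misses 0; the resulting gap is the radius of a box inside
      \<open>W\<close>.\<close>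
    have "closedin ?T (topspace ?T - W)"
      using W by blast
    then have "compactin ?T (topspace ?T - W)"
      using compactin_unit_cube compact_space_subtopology closedin_compact_space by blast
    then have "compactin euclideanreal (\<delta> ` (topspace ?T - W))"
      using image_compactin cont_\<delta> by blast
    then have "open (- \<delta> ` (topspace ?T - W))"
      by (intro open_Compl compact_imp_closed) (simp only: compactin_euclidean_iff)
    moreover have "0 \<in> - \<delta> ` (topspace ?T - W)"
      using \<delta>_0 q top by force
    ultimately obtain e where e: "e > 0" "\<And>x. dist x 0 < e \<Longrightarrow> x \<in> - \<delta> ` (topspace ?T - W)"
      unfolding open_dist by blast
    define V where "V = {p \<in> topspace ?T. \<delta> p \<in> {..<e}}"
    have V: "openin ?T V"
      unfolding V_def by (intro openin_continuous_map_preimage[OF cont_\<delta>]) simp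
    have "\<delta> q \<le> 0"
      unfolding \<delta>_def by (subst gauge_max_le_iff) auto
    then have "q \<in> V"
      using e(1) qc top by (auto simp: V_def)
    moreover have "V \<subseteq> W"
    proof
      fix p assume "p \<in> V"
      then have p: "p \<in> topspace ?T" "\<delta> p < e" by (auto simp: V_def)
      have "0 \<le> \<delta> p" unfolding \<delta>_def by (rule gauge_max_nonneg)
      then have "\<delta> p \<in> - \<delta> ` (topspace ?T - W)" using p e(2) by simp
      then show "p \<in> W" using p(1) by blast
    qed
    moreover have "connectedin ?T (V \<inter> {q \<in> topspace ?T. \<rho> q < t})"
      unfolding connectedin_subtopology V_def top
    proof (intro conjI connectedin_seg_convex)
      show "{p \<in> unit_cube k. \<delta> p \<in> {..<e}} \<inter> {q \<in> unit_cube k. \<rho> q < t} \<subseteq> topspace ?E"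
        using unit_cube_subset by blast
      fix v w u
      assume vw: "v \<in> {p \<in> unit_cube k. \<delta> p \<in> {..<e}} \<inter> {q \<in> unit_cube k. \<rho> q < t}"
        "w \<in> {p \<in> unit_cube k. \<delta> p \<in> {..<e}} \<inter> {q \<in> unit_cube k. \<rho> q < t}"
        and u: "0 \<le> u" "u \<le> (1::real)"
      have "\<bar>seg u v w i - q i\<bar> < e" if "i < k" for i
      proof -
        have *: "\<bar>v i - q i\<bar> < e" "\<bar>w i - q i\<bar> < e"
          using vw that e(1) by (auto simp: \<delta>_def gauge_max_less_iff)
        have "seg u v w i - q i = (1 - u) * (v i - q i) + u * (w i - q i)"
          by (simp add: seg_def algebra_simps)
        also have "\<bar>\<dots>\<bar> \<le> (1 - u) * \<bar>v i - q i\<bar> + u * \<bar>w i - q i\<bar>"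
          using u abs_triangle_ineq[of "(1 - u) * (v i - q i)" "u * (w i - q i)"] by (simp add: abs_mult)
        also have "\<dots> < e"
          using convex_bound_lt[OF *, of "1 - u" u] u by simp
        finally show ?thesis .
      qed
      then have "\<delta> (seg u v w) < e"
        unfolding \<delta>_def using e(1) by (subst gauge_max_less_iff) auto
      then show "seg u v w \<in> {p \<in> unit_cube k. \<delta> p \<in> {..<e}} \<inter> {q \<in> unit_cube k. \<rho> q < t}"
        using vw u seg_cube sub_seg by auto
    qed auto
    ultimately show "\<exists>V. openin ?T V \<and> q \<in> V \<and> V \<subseteq> W \<and> connectedin ?T (V \<inter> {q \<in> topspace ?T. \<rho> q < t})"
      using V by blast
  qed
  with less_iff show thesis using that by blast
qed

context star_gauge
begin

abbreviation sublevel where "sublevel t \<equiv> {q \<in> topspace T. \<rho> q < t}"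
abbreviation closed_sublevel where "closed_sublevel t \<equiv> {q \<in> topspace T. \<rho> q \<le> t}"

lemma openin_sublevel: "openin T (sublevel t)"
  using openin_continuous_map_preimage[OF continuous_\<rho>, of "{..<t}"] by simp

lemma closedin_closed_sublevel: "closedin T (closed_sublevel t)"
  using closedin_continuous_map_preimage[OF continuous_\<rho>, of "{..t}"] by simp

lemma closure_of_sublevel:
  assumes "0 < t" shows "T closure_of sublevel t = closed_sublevel t"
proof
  show "T closure_of sublevel t \<subseteq> closed_sublevel t"
    by (rule closure_of_minimal[OF _ closedin_closed_sublevel]) auto
qed (use closure_sublevel assms in auto)

lemma closed_sublevel_0: "closed_sublevel 0 = {a}"
proof -
  have "\<rho> q \<le> 0 \<longleftrightarrow> q = a" if "q \<in> topspace T" for q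
    using \<rho>_nonneg[OF that] \<rho>_eq_0[OF that] by linarith
  then show ?thesis using center by auto
qed

lemma connectedin_closed_sublevel:
  assumes "0 \<le> t" shows "connectedin T (closed_sublevel t)"
proof (cases "t = 0")
  case True
  then show ?thesis using closed_sublevel_0 center by simp
next
  case False
  then show ?thesis
    using assms connectedin_closure_of[OF connectedin_sublevel[of t]] by (simp add: closure_of_sublevel)
qed

text \<open>The values of \<rho> off \<open>W\<close> form a compact set that does not contain
  \<open>t\<close>, so they miss an interval around \<open>t\<close>.\<close>

lemma closed_sublevel_enlarge:
  assumes W: "openin T W" and sub: "closed_sublevel t \<subseteq> W"
  obtains t' where "t < t'" "closed_sublevel t' \<subseteq> W"
proof -
  have "compactin T (topspace T - W)"
    using W compact_T closedin_compact_space by blast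
  then have "compactin euclideanreal (\<rho> ` (topspace T - W))"
    using image_compactin continuous_\<rho> by blast
  then have "open (- \<rho> ` (topspace T - W))"
    by (intro open_Compl compact_imp_closed) (simp only: compactin_euclidean_iff)
  moreover have "t \<in> - \<rho> ` (topspace T - W)"
    using sub by fastforce
  ultimately obtain e where e: "e > 0" "\<And>x. dist x t < e \<Longrightarrow> x \<in> - \<rho> ` (topspace T - W)"
    unfolding open_dist by blast
  have "closed_sublevel (t + e/2) \<subseteq> W"
  proof clarify
    fix q assume q: "q \<in> topspace T" "\<rho> q \<le> t + e/2"
    show "q \<in> W"
    proof (cases "\<rho> q \<le> t")
      case True then show ?thesis using sub q by blast
    next
      case False
      then have "dist (\<rho> q) t < e" using q e(1) by (simp add: dist_real_def)
      then show ?thesis using e(2) q by blast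
    qed
  qed
  with that[of "t + e/2"] e(1) show thesis by simp
qed

end

section \<open>Lifting cubes through open maps\<close>

text \<open>Branching transversal to the preimage of \<open>C\<close> is allowed: only points with a
  common value in \<open>C\<close> have to be separated. Thus branch points can qualify, as 0 does
  for squaring a complex number with C = {0}.\<close>

definition locally_injective_over :: "'a topology \<Rightarrow> ('a \<Rightarrow> 'b) \<Rightarrow> 'b set \<Rightarrow> bool" where
  "locally_injective_over X f C \<longleftrightarrow>
     (\<forall>x\<in>topspace X. f x \<in> C \<longrightarrow> (\<exists>U. openin X U \<and> x \<in> U \<and> inj_on f (U \<inter> f -` C)))"

lemma locally_injective_over_subset:
  "\<lbrakk>locally_injective_over X f C; C' \<subseteq> C\<rbrakk> \<Longrightarrow> locally_injective_over X f C'"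
  unfolding locally_injective_over_def by (meson inj_on_subset Int_mono order_refl subsetD vimage_mono)

text \<open>The set where the two lifts coincide is closed because \<open>X\<close> is Hausdorff and
  open by local injectivity over \<open>C\<close>; connectedness finishes.\<close>

lemma lifts_agree:
  assumes Z: "connected_space Z" and X: "Hausdorff_space X"
    and s: "continuous_map Z X s" and t: "continuous_map Z X t"
    and eq: "\<And>z. z \<in> topspace Z \<Longrightarrow> f (s z) = f (t z)"
    and C: "\<And>z. z \<in> topspace Z \<Longrightarrow> f (s z) \<in> C"
    and inj: "locally_injective_over X f C"
    and z0: "z0 \<in> topspace Z" "s z0 = t z0"
    and z: "z \<in> topspace Z"
  shows "s z = t z"
proof -
  let ?A = "{z \<in> topspace Z. s z = t z}"
  have "closedin Z ?A"
    using X s t closedin_continuous_maps_eq by blast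
  moreover have "openin Z ?A"
  proof (subst openin_subopen, intro ballI)
    fix y assume y: "y \<in> ?A"
    then have "s y \<in> topspace X"
      using s continuous_map_funspace by fastforce
    then obtain U where U: "openin X U" "s y \<in> U" "inj_on f (U \<inter> f -` C)"
      using inj C y unfolding locally_injective_over_def by blast
    let ?V = "{z \<in> topspace Z. s z \<in> U} \<inter> {z \<in> topspace Z. t z \<in> U}"
    have "openin Z ?V"
      using openin_continuous_map_preimage s t U(1) by blast
    moreover have "y \<in> ?V" using y U(2) by auto
    moreover have "?V \<subseteq> ?A"
    proof
      fix z assume z: "z \<in> ?V"
      then have "f (s z) \<in> C" "f (t z) \<in> C" "f (s z) = f (t z)"
        using C eq by fastforce+
      then show "z \<in> ?A"
        using z inj_onD[OF U(3)] by blast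
    qed
    ultimately show "\<exists>V. openin Z V \<and> y \<in> V \<and> V \<subseteq> ?A" by blast
  qed
  ultimately have "?A = topspace Z"
    using Z z0 unfolding connected_space_clopen_in by blast
  then show ?thesis using z by blast
qed

text \<open>Pairs in K x K either have distinct values or lie on the diagonal, where local
  injectivity applies. Compactness then fits a product neighbourhood of K x K into the open set of
  good pairs.\<close>

lemma injective_near_compact:
  assumes X: "Hausdorff_space X" and Y: "Hausdorff_space Y" and f: "continuous_map X Y f"
    and inj: "locally_injective_over X f C"
    and K: "compactin X K" "f ` K \<subseteq> C" "inj_on f K"
  obtains W where "openin X W" "K \<subseteq> W" "inj_on f (W \<inter> f -` C)"
proof -
  \<comment> \<open>\<open>G\<close> is an open set whose points over \<open>C\<close> are the pairs that do not violate injectivity.\<close>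
  define G where "G = {p \<in> topspace (prod_topology X X). f (fst p) \<noteq> f (snd p)} \<union>
    \<Union>{U \<times> U |U. openin X U \<and> inj_on f (U \<inter> f -` C)}"
  have "closedin (prod_topology X X) {p \<in> topspace (prod_topology X X). f (fst p) = f (snd p)}"
    by (intro closedin_continuous_maps_eq[OF Y]
        continuous_map_compose[OF continuous_map_fst f, unfolded comp_def]
        continuous_map_compose[OF continuous_map_snd f, unfolded comp_def])
  then have "openin (prod_topology X X) (topspace (prod_topology X X)
      - {p \<in> topspace (prod_topology X X). f (fst p) = f (snd p)})"
    by blast
  moreover have "topspace (prod_topology X X)
      - {p \<in> topspace (prod_topology X X). f (fst p) = f (snd p)}
      = {p \<in> topspace (prod_topology X X). f (fst p) \<noteq> f (snd p)}"
    by blast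
  ultimately have "openin (prod_topology X X) {p \<in> topspace (prod_topology X X). f (fst p) \<noteq> f (snd p)}"
    by simp
  then have G: "openin (prod_topology X X) G"
    unfolding G_def by (intro openin_Un openin_Union) (auto simp: openin_prod_Times_iff)
  have KX: "K \<subseteq> topspace X"
    using K(1) compactin_subset_topspace by blast
  have "K \<times> K \<subseteq> G"
  proof clarify
    fix x y assume xy: "x \<in> K" "y \<in> K"
    show "(x, y) \<in> G"
    proof (cases "x = y")
      case True
      then obtain U where "openin X U" "x \<in> U" "inj_on f (U \<inter> f -` C)"
        using inj xy K(2) KX unfolding locally_injective_over_def by blast
      then show ?thesis using True unfolding G_def by blast
    next
      case False
      then have "f x \<noteq> f y"
        using K(3) xy by (auto dest: inj_onD)
      then show ?thesis using xy KX by (auto simp: G_def)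
    qed
  qed
  then obtain U V where UV: "openin X U" "openin X V" "K \<subseteq> U" "K \<subseteq> V" "U \<times> V \<subseteq> G"
    using Wallace_theorem_prod_topology[OF K(1) K(1) G] by metis
  have "inj_on f (U \<inter> V \<inter> f -` C)"
  proof (rule inj_onI)
    fix x y assume x: "x \<in> U \<inter> V \<inter> f -` C" and y: "y \<in> U \<inter> V \<inter> f -` C" and eq: "f x = f y"
    have "(x, y) \<in> G" using x y UV(5) by blast
    then obtain U' where "inj_on f (U' \<inter> f -` C)" "x \<in> U'" "y \<in> U'"
      using eq unfolding G_def by auto
    then show "x = y"
      using x y eq by (auto dest: inj_onD)
  qed
  then show thesis
    using that[of "U \<inter> V"] UV by blast
qed

lemma finite_disjoint_neighbourhoods:
  assumes X: "Hausdorff_space X" and F: "finite F" "F \<subseteq> topspace X"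
  obtains N where "\<And>x. x \<in> F \<Longrightarrow> openin X (N x) \<and> x \<in> N x"
    and "\<And>x y. \<lbrakk>x \<in> F; y \<in> F; x \<noteq> y\<rbrakk> \<Longrightarrow> N x \<inter> N y = {}"
proof -
  have "\<exists>N. (\<forall>x\<in>F. openin X (N x) \<and> x \<in> N x) \<and> (\<forall>x\<in>F. \<forall>y\<in>F. x \<noteq> y \<longrightarrow> N x \<inter> N y = {})"
    using F
  proof (induction F)
    case (insert z F)
    then obtain N where N: "\<forall>x\<in>F. openin X (N x) \<and> x \<in> N x"
        "\<forall>x\<in>F. \<forall>y\<in>F. x \<noteq> y \<longrightarrow> N x \<inter> N y = {}"
      by auto
    have "compactin X F" "compactin X {z}" "disjnt F {z}"
      using insert by (auto simp: finite_imp_compactin)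
    then obtain U V where UV: "openin X U" "openin X V" "F \<subseteq> U" "z \<in> V" "disjnt U V"
      using Hausdorff_space_compact_separation[OF X] by (metis insert_subset)
    define N' where "N' x = (if x = z then V else N x \<inter> U)" for x
    have "\<forall>x\<in>insert z F. openin X (N' x) \<and> x \<in> N' x"
      using N(1) UV(1-4) by (simp add: N'_def openin_Int subset_iff)
    moreover have "\<forall>x\<in>insert z F. \<forall>y\<in>insert z F. x \<noteq> y \<longrightarrow> N' x \<inter> N' y = {}"
    proof (intro ballI impI)
      fix x y assume "x \<in> insert z F" "y \<in> insert z F" "x \<noteq> y"
      then consider "x = z" "y \<noteq> z" | "y = z" "x \<noteq> z" | "x \<in> F" "y \<in> F" "x \<noteq> z" "y \<noteq> z"
        by blast
      then show "N' x \<inter> N' y = {}"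
      proof cases
        case 3
        then have "N x \<inter> N y = {}" using N(2) \<open>x \<noteq> y\<close> by blast
        then show ?thesis using 3 by (auto simp: N'_def)
      qed (use UV(5) in \<open>auto simp: disjnt_def N'_def\<close>)
    qed
    ultimately show ?case by (intro exI[of _ N'] conjI)
  qed auto
  then obtain N where N: "\<forall>x\<in>F. openin X (N x) \<and> x \<in> N x"
      "\<forall>x\<in>F. \<forall>y\<in>F. x \<noteq> y \<longrightarrow> N x \<inter> N y = {}"
    by (elim exE conjE)
  show thesis
    by (rule that[of N]) (use N in \<open>simp_all\<close>)
qed

text \<open>A lift defined on a dense set that is locally connected at the boundary has boundary limits:
  near a boundary point the lift stays in small neighbourhoods of the finite fibre, hence near a
  single fibre point.\<close>

lemma lift_limit:
  assumes X: "compact_space X" "Hausdorff_space X" and Y: "Hausdorff_space Y"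
    and f: "continuous_map X Y f" and g: "continuous_map T Y g"
    and fin: "finite {x \<in> topspace X. f x = g v}"
    and s: "continuous_map (subtopology T S) X s" and ST: "S \<subseteq> topspace T"
    and fs: "\<And>q. q \<in> S \<Longrightarrow> f (s q) = g q"
    and v: "v \<in> T closure_of S"
    and loc: "\<And>W. \<lbrakk>openin T W; v \<in> W\<rbrakk> \<Longrightarrow> \<exists>V. openin T V \<and> v \<in> V \<and> V \<subseteq> W \<and> connectedin T (V \<inter> S)"
  obtains l where "limitin X s l (atin_within T v S)"
proof -
  let ?F = "{x \<in> topspace X. f x = g v}"
  have vT: "v \<in> topspace T" using v by (simp add: in_closure_of)
  obtain N where N: "\<And>x. x \<in> ?F \<Longrightarrow> openin X (N x) \<and> x \<in> N x"
      "\<And>x y. \<lbrakk>x \<in> ?F; y \<in> ?F; x \<noteq> y\<rbrakk> \<Longrightarrow> N x \<inter> N y = {}"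
    using finite_disjoint_neighbourhoods[OF X(2) fin] by (metis (no_types, lifting) mem_Collect_eq subsetI)
  \<comment> \<open>The points of \<open>X\<close> outside the chosen neighbourhoods of the fibre
    have a closed image missing \<open>g v\<close>. For \<open>q\<close> close to \<open>v\<close>
    the value \<open>g q\<close> misses this image too, which forces \<open>s q\<close> into one of
    the neighbourhoods.\<close>
  have near: "\<exists>W. openin T W \<and> v \<in> W \<and> (\<forall>q\<in>W \<inter> S. \<exists>x\<in>?F. s q \<in> N' x)"
    if N': "\<And>x. x \<in> ?F \<Longrightarrow> openin X (N' x) \<and> x \<in> N' x" for N'
  proof -
    let ?K = "topspace X - \<Union>(N' ` ?F)"
    have "closedin X ?K"
      using N' by (intro closedin_diff openin_Union) auto
    then have "closedin Y (f ` ?K)"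
      using continuous_imp_closed_map[OF f X(1) Y] by (auto simp: closed_map_def)
    then have "openin T {q \<in> topspace T. g q \<in> topspace Y - f ` ?K}"
      by (intro openin_continuous_map_preimage[OF g]) blast
    moreover have "v \<in> {q \<in> topspace T. g q \<in> topspace Y - f ` ?K}"
      using vT N' continuous_map_funspace[OF g] by fastforce
    moreover have "\<exists>x\<in>?F. s q \<in> N' x"
      if q: "q \<in> {q \<in> topspace T. g q \<in> topspace Y - f ` ?K} \<inter> S" for q
    proof -
      have "s q \<in> topspace X"
        using q ST continuous_map_funspace[OF s] by (auto simp: inf_absorb2)
      moreover have "s q \<notin> ?K"
        using q fs by (metis (no_types, lifting) Diff_iff IntE image_eqI mem_Collect_eq)
      ultimately show ?thesis by blast
    qed
    ultimately show ?thesis by blast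
  qed
  obtain W where W: "openin T W" "v \<in> W" "\<And>q. q \<in> W \<inter> S \<Longrightarrow> \<exists>x\<in>?F. s q \<in> N x"
    using near[of N] N(1) by blast
  obtain V where V: "openin T V" "v \<in> V" "V \<subseteq> W" "connectedin T (V \<inter> S)"
    using loc[OF W(1,2)] by blast
  obtain q0 where q0: "q0 \<in> V \<inter> S"
    using v V(1,2) unfolding in_closure_of by blast
  then obtain x where x: "x \<in> ?F" "s q0 \<in> N x"
    using W(3) V(3) by blast
  \<comment> \<open>The connected image cannot be split between disjoint neighbourhoods, so the
    fibre point met at \<open>q0\<close> is the only candidate for the limit.\<close>
  have conn: "connectedin X (s ` (V \<inter> S))"
    using V(4) by (intro connectedin_continuous_map_image[OF s]) (auto simp: connectedin_subtopology)
  have sV: "s q \<in> N x" if q: "q \<in> V \<inter> S" for q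
  proof (rule ccontr)
    assume "s q \<notin> N x"
    then obtain y where y: "y \<in> ?F" "s q \<in> N y" "y \<noteq> x"
      using W(3) V(3) q by blast
    let ?B = "\<Union>(N ` (?F - {x}))"
    have "openin X (N x)" "openin X ?B"
      using N(1) x(1) by auto
    moreover have "s ` (V \<inter> S) \<subseteq> N x \<union> ?B"
      using W(3) V(3) by fast
    moreover have "N x \<inter> ?B = {}"
      using N(2) x(1) by blast
    ultimately show False
      using conn q0 q x y unfolding connectedin by blast
  qed
  have "limitin X s x (atin_within T v S)"
    unfolding limitin_def
  proof (intro conjI allI impI)
    show "x \<in> topspace X" using x by blast
    fix U assume U: "openin X U \<and> x \<in> U"
    \<comment> \<open>Only the neighbourhood of \<open>x\<close> shrinks. Near \<open>v\<close> the
      lift is already known to avoid the neighbourhoods of the other fibre points.\<close>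
    define N' where "N' = N(x := N x \<inter> U)"
    have "\<And>y. y \<in> ?F \<Longrightarrow> openin X (N' y) \<and> y \<in> N' y"
      using N(1) U by (auto simp: N'_def)
    then obtain W' where W': "openin T W'" "v \<in> W'" "\<And>q. q \<in> W' \<inter> S \<Longrightarrow> \<exists>x\<in>?F. s q \<in> N' x"
      using near[of N'] by blast
    have "s q \<in> U" if q: "q \<in> V \<inter> W'" "q \<in> S" for q
    proof -
      obtain y where y: "y \<in> ?F" "s q \<in> N' y" using W'(3) q by blast
      then have "y = x"
        using sV[of q] q N(2)[of x y] x(1) by (auto simp: N'_def split: if_splits)
      then show ?thesis using y by (simp add: N'_def)
    qed
    then show "eventually (\<lambda>q. s q \<in> U) (atin_within T v S)"
      unfolding eventually_atin_within using V(1,2) W'(1,2)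
      by (metis Int_iff openin_Int)
  qed
  then show thesis using that by blast
qed

context star_gauge
begin

text \<open>In a regular space, pointwise limits at all frontier points already give a continuous
  extension. The equation with \<open>g\<close> passes to the closure because \<open>Y\<close> is
  Hausdorff.\<close>

lemma lift_extends_to_closed_sublevel:
  assumes X: "compact_space X" "Hausdorff_space X" and Y: "Hausdorff_space Y"
    and f: "continuous_map X Y f" and g: "continuous_map T Y g"
    and fin: "\<And>y. y \<in> topspace Y \<Longrightarrow> finite {x \<in> topspace X. f x = y}"
    and s: "continuous_map (subtopology T (sublevel t)) X s"
    and fs: "\<And>q. q \<in> sublevel t \<Longrightarrow> f (s q) = g q"
    and t: "0 < t"
  obtains s' where "continuous_map (subtopology T (closed_sublevel t)) X s'"
    "\<And>q. q \<in> closed_sublevel t \<Longrightarrow> f (s' q) = g q"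
    "\<And>q. q \<in> sublevel t \<Longrightarrow> s' q = s q"
proof -
  have reg: "regular_space X"
    using X compact_Hausdorff_imp_regular_space by blast
  have lim: "\<exists>l. limitin X s l (atin_within T v (sublevel t))"
    if v: "v \<in> closed_sublevel t - sublevel t" for v
  proof -
    have "g v \<in> topspace Y" using v continuous_map_funspace[OF g] by auto
    then show ?thesis
      using lift_limit[OF X Y f g fin s _ fs, of v] locally_connected_sublevel[OF t]
        closure_sublevel[OF t] v
      by (smt (verit) DiffE mem_Collect_eq subsetI)
  qed
  obtain s' where s': "continuous_map (subtopology T (closed_sublevel t)) X s'"
    "\<And>q. q \<in> sublevel t \<Longrightarrow> s' q = s q"
    using continuous_map_extension_pointwise_alt[OF reg _ _ s lim] closure_of_sublevel[OF t]
    by (metis (no_types, lifting) closure_of_subset mem_Collect_eq subsetI order_refl)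
  have "f (s' q) = g q" if q: "q \<in> closed_sublevel t" for q
  proof (rule forall_in_closure_of_eq[where X = "subtopology T (closed_sublevel t)"
        and S = "sublevel t" and f = "f \<circ> s'", OF _ Y, unfolded comp_def])
    have "q \<in> T closure_of sublevel t"
      using q closure_of_sublevel[OF t] by simp
    then show "q \<in> subtopology T (closed_sublevel t) closure_of sublevel t"
      using q by (subst closure_of_subtopology_open) auto
    show "continuous_map (subtopology T (closed_sublevel t)) Y (\<lambda>x. f (s' x))"
      using continuous_map_compose[OF s'(1) f] by (simp add: comp_def)
    show "continuous_map (subtopology T (closed_sublevel t)) Y g"
      by (intro continuous_map_from_subtopology g)
    fix x assume "x \<in> sublevel t"
    then show "f (s' x) = g x" using s'(2) fs by simp
  qed
  then show thesis using that s' by blast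
qed

text \<open>Near the compact image of the lift, \<open>f\<close> is injective over the open cell, so
  it has a unique inverse there; openness of \<open>f\<close> makes this inverse continuous and
  defined over a neighbourhood of the closed sublevel.\<close>

lemma lift_enlarges:
  assumes X: "Hausdorff_space X" and Y: "Hausdorff_space Y"
    and f: "continuous_map X Y f" "open_map X Y f" and g: "continuous_map T Y g" "inj_on g (topspace T)"
    and inj: "locally_injective_over X f (g ` sublevel 1)"
    and s: "continuous_map (subtopology T (closed_sublevel t)) X s"
    and fs: "\<And>q. q \<in> closed_sublevel t \<Longrightarrow> f (s q) = g q"
    and t: "0 \<le> t" "t < 1"
  obtains t' s' where "t < t'" "t' \<le> 1" "continuous_map (subtopology T (closed_sublevel t')) X s'"
    "\<And>q. q \<in> closed_sublevel t' \<Longrightarrow> f (s' q) = g q" "s' a = s a"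
proof -
  let ?C = "g ` sublevel 1" and ?K = "s ` closed_sublevel t"
  have "compactin (subtopology T (closed_sublevel t)) (closed_sublevel t)"
    using closedin_compact_space[OF compact_T closedin_closed_sublevel]
    by (simp add: compactin_subtopology)
  then have K: "compactin X ?K"
    using image_compactin s by blast
  have fK: "f ` ?K \<subseteq> ?C"
    using fs t by force
  have injK: "inj_on f ?K"
  proof (rule inj_onI)
    fix x y assume xy: "x \<in> ?K" "y \<in> ?K" "f x = f y"
    then obtain p q where "p \<in> closed_sublevel t" "x = s p" "q \<in> closed_sublevel t" "y = s q"
      by blast
    moreover from this have "p = q"
      using xy(3) fs g(2) by (auto dest: inj_onD)
    ultimately show "x = y" by simp
  qed
  obtain W where W: "openin X W" "?K \<subseteq> W" "inj_on f (W \<inter> f -` ?C)"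
    using injective_near_compact[OF X Y f(1) inj K fK injK] .
  have "openin Y (f ` W)"
    using f(2) W(1) by (simp add: open_map_def)
  then have "openin T {q \<in> topspace T. g q \<in> f ` W}"
    using openin_continuous_map_preimage[OF g(1)] by blast
  moreover have "closed_sublevel t \<subseteq> {q \<in> topspace T. g q \<in> f ` W}"
  proof
    fix q assume "q \<in> closed_sublevel t"
    then show "q \<in> {q \<in> topspace T. g q \<in> f ` W}"
      using fs[of q] W(2) by (auto intro!: image_eqI[of _ f "s q"])
  qed
  ultimately obtain t1 where t1: "t < t1" "closed_sublevel t1 \<subseteq> {q \<in> topspace T. g q \<in> f ` W}"
    using closed_sublevel_enlarge by blast
  \<comment> \<open>The new parameter stays below 1, since injectivity on \<open>W\<close> is
    available only over the image of \<open>sublevel 1\<close>.\<close>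
  define t' where "t' = min t1 ((1 + t) / 2)"
  have t': "t < t'" "t' < 1" "t' \<le> t1"
    using t1 t by (auto simp: t'_def min_def)
  define s' where "s' q = (SOME x. x \<in> W \<and> f x = g q)" for q
  have s': "s' q \<in> W \<and> f (s' q) = g q" if q: "q \<in> closed_sublevel t'" for q
  proof -
    have "g q \<in> f ` W" using q t1(2) t'(3) by auto
    then have "\<exists>x. x \<in> W \<and> f x = g q" by force
    then show ?thesis unfolding s'_def by (rule someI_ex)
  qed
  have s'_eq: "x = s' q" if "q \<in> closed_sublevel t'" "x \<in> W" "f x = g q" for x q
    using inj_onD[OF W(3), of x "s' q"] s'[OF that(1)] that t'(2) by auto
  have "continuous_map (subtopology T (closed_sublevel t')) X s'"
    unfolding continuous_map_def
  proof (intro conjI allI impI)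
    show "s' \<in> topspace (subtopology T (closed_sublevel t')) \<rightarrow> topspace X"
      using s' openin_subset[OF W(1)] by auto
    fix U assume U: "openin X U"
    \<comment> \<open>By uniqueness of the chosen preimage, \<open>s' q\<close> lies in
      \<open>U\<close> exactly when \<open>g q\<close> has some preimage in U \<inter> W; the image
      of that set is open.\<close>
    have "{q \<in> topspace (subtopology T (closed_sublevel t')). s' q \<in> U}
        = {q \<in> topspace T. g q \<in> f ` (U \<inter> W)} \<inter> closed_sublevel t'"
    proof (intro equalityI subsetI)
      fix q assume q: "q \<in> {q \<in> topspace (subtopology T (closed_sublevel t')). s' q \<in> U}"
      then have "s' q \<in> U \<inter> W" "f (s' q) = g q" using s' by auto
      then have "g q \<in> f ` (U \<inter> W)" by force
      then show "q \<in> {q \<in> topspace T. g q \<in> f ` (U \<inter> W)} \<inter> closed_sublevel t'" using q by auto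
    next
      fix q assume q: "q \<in> {q \<in> topspace T. g q \<in> f ` (U \<inter> W)} \<inter> closed_sublevel t'"
      then obtain x where "x \<in> U" "x \<in> W" "f x = g q" by force
      then show "q \<in> {q \<in> topspace (subtopology T (closed_sublevel t')). s' q \<in> U}"
        using s'_eq q by fastforce
    qed
    moreover have "openin T {q \<in> topspace T. g q \<in> f ` (U \<inter> W)}"
      using f(2) U W(1) by (intro openin_continuous_map_preimage[OF g(1)]) (simp add: open_map_def openin_Int)
    ultimately show "openin (subtopology T (closed_sublevel t'))
        {q \<in> topspace (subtopology T (closed_sublevel t')). s' q \<in> U}"
      by (auto simp: openin_subtopology)
  qed
  moreover have "s' a = s a"
  proof -
    have a: "a \<in> closed_sublevel t" using closed_sublevel_0 t(1) by auto
    then show ?thesis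
      using s'_eq[of a "s a"] W(2) fs t'(1) by fastforce
  qed
  ultimately show thesis
    using that[of t' s'] t' s' by simp
qed

text \<open>Continuity method: the parameters that admit a lift starting at \<open>x0\<close> are
  closed downwards, can be enlarged below 1, and survive limits from below. Hence their supremum is
  attained and equals 1, where the closed sublevel is the whole space.\<close>

theorem lift_exists:
  assumes X: "compact_space X" "Hausdorff_space X" and Y: "Hausdorff_space Y"
    and f: "continuous_map X Y f" "open_map X Y f"
    and fin: "\<And>y. y \<in> topspace Y \<Longrightarrow> finite {x \<in> topspace X. f x = y}"
    and g: "continuous_map T Y g" "inj_on g (topspace T)"
    and inj: "locally_injective_over X f (g ` sublevel 1)"
    and x0: "x0 \<in> topspace X" "f x0 = g a"
  obtains s where "continuous_map T X s" "\<And>q. q \<in> topspace T \<Longrightarrow> f (s q) = g q" "s a = x0"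
proof -
  define L where "L t s \<longleftrightarrow> continuous_map (subtopology T (closed_sublevel t)) X s \<and>
    (\<forall>q\<in>closed_sublevel t. f (s q) = g q) \<and> s a = x0" for t s
  define A where "A = {t. 0 \<le> t \<and> t \<le> 1 \<and> (\<exists>s. L t s)}"
  have a_in: "a \<in> closed_sublevel t" "0 < t \<Longrightarrow> a \<in> sublevel t" if "0 \<le> t" for t
    using closed_sublevel_0 that by auto
  have A0: "0 \<in> A"
  proof -
    have "L 0 (\<lambda>_. x0)"
      using x0 unfolding L_def closed_sublevel_0 by simp
    then show ?thesis by (auto simp: A_def)
  qed
  have down: "t' \<in> A" if t: "t \<in> A" and t': "0 \<le> t'" "t' \<le> t" for t t'
  proof -
    obtain s where s: "L t s" using t by (auto simp: A_def)
    have sub: "closed_sublevel t' \<subseteq> closed_sublevel t" using t' by auto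
    have "L t' s"
      using s sub unfolding L_def by (meson continuous_map_from_subtopology_mono subsetD)
    then show ?thesis using t t' by (auto simp: A_def)
  qed
  have enlarge: "\<exists>t'\<in>A. t < t'" if tA: "t \<in> A" "t < 1" for t
  proof -
    obtain s where s: "L t s" and "0 \<le> t" using tA unfolding A_def by blast
    have s': "continuous_map (subtopology T (closed_sublevel t)) X s"
      "\<And>q. q \<in> closed_sublevel t \<Longrightarrow> f (s q) = g q" "s a = x0"
      using s unfolding L_def by blast+
    show ?thesis
    proof (rule lift_enlarges[OF X(2) Y f g inj s'(1,2) \<open>0 \<le> t\<close> tA(2)])
      fix t' r assume r: "t < t'" "t' \<le> 1" "continuous_map (subtopology T (closed_sublevel t')) X r"
        "\<And>q. q \<in> closed_sublevel t' \<Longrightarrow> f (r q) = g q" "r a = s a"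
      have "L t' r" unfolding L_def using r(3-5) s'(3) by simp
      then have "t' \<in> A" unfolding A_def using r(1,2) \<open>0 \<le> t\<close> by auto
      then show "\<exists>t'\<in>A. t < t'" using r(1) by blast
    qed
  qed
  have limit: "t \<in> A" if t: "0 < t" "t \<le> 1" and below: "\<And>r. \<lbrakk>0 \<le> r; r < t\<rbrakk> \<Longrightarrow> r \<in> A" for t
  proof -
    define \<sigma> where "\<sigma> r = (SOME s. L r s)" for r
    have \<sigma>: "L r (\<sigma> r)" if r: "0 \<le> r" "r < t" for r
    proof -
      have "\<exists>s. L r s" using below[OF r] unfolding A_def by blast
      then show ?thesis unfolding \<sigma>_def by (rule someI_ex)
    qed
    \<comment> \<open>Both lifts start at \<open>x0\<close>. As r < t \<le> 1, the sublevel stays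
      over the region where \<open>f\<close> is locally injective, so the chosen lifts are
      compatible and can be pasted.\<close>
    have agree: "\<sigma> r q = \<sigma> r' q" if r: "0 \<le> r" "r \<le> r'" "r' < t" and q: "q \<in> closed_sublevel r" for r r' q
    proof (rule lifts_agree[where Z = "subtopology T (closed_sublevel r)" and C = "g ` sublevel 1" and f = f, OF _ X(2)])
      show "connected_space (subtopology T (closed_sublevel r))"
        using connectedin_closed_sublevel[OF r(1)] by (simp add: connectedin_def)
      have sub: "closed_sublevel r \<subseteq> closed_sublevel r'" using r by auto
      show "continuous_map (subtopology T (closed_sublevel r)) X (\<sigma> r)"
        using \<sigma>[of r] r unfolding L_def by auto
      show "continuous_map (subtopology T (closed_sublevel r)) X (\<sigma> r')"
        using \<sigma>[of r'] r sub unfolding L_def by (meson continuous_map_from_subtopology_mono order_trans)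
      show "locally_injective_over X f (g ` sublevel 1)" by (rule inj)
      show "a \<in> topspace (subtopology T (closed_sublevel r))" using a_in[OF r(1)] by simp
      show "\<sigma> r a = \<sigma> r' a" using \<sigma>[of r] \<sigma>[of r'] r unfolding L_def by auto
      show "q \<in> topspace (subtopology T (closed_sublevel r))" using q by simp
      fix z assume z: "z \<in> topspace (subtopology T (closed_sublevel r))"
      then have z1: "z \<in> closed_sublevel r" "z \<in> closed_sublevel r'" "z \<in> sublevel 1"
        using sub r t by auto
      have "f (\<sigma> r z) = g z" "f (\<sigma> r' z) = g z"
        using \<sigma>[of r] \<sigma>[of r'] r z1 unfolding L_def by simp_all
      then show "f (\<sigma> r z) = f (\<sigma> r' z)" "f (\<sigma> r z) \<in> g ` sublevel 1"
        using z1(3) by simp_all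
    qed
    have agree': "\<sigma> r q = \<sigma> r' q"
      if "0 \<le> r" "r < t" "0 \<le> r'" "r' < t" "q \<in> closed_sublevel r" "q \<in> closed_sublevel r'" for r r' q
    proof (cases "r \<le> r'")
      case True
      then show ?thesis by (intro agree that)
    next
      case False
      then have "\<sigma> r' q = \<sigma> r q" by (intro agree that) simp
      then show ?thesis by simp
    qed
    obtain \<tau> where \<tau>: "continuous_map (subtopology T (sublevel t)) X \<tau>"
      "\<And>q r. \<lbrakk>r \<in> {0..<t}; q \<in> topspace (subtopology T (sublevel t)) \<inter> sublevel r\<rbrakk> \<Longrightarrow> \<tau> q = \<sigma> r q"
    proof (rule pasting_lemma_exists[where X = "subtopology T (sublevel t)" and I = "{0..<t}"
          and T = sublevel and f = \<sigma> and Y = X])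
      show "topspace (subtopology T (sublevel t)) \<subseteq> (\<Union>r\<in>{0..<t}. sublevel r)"
      proof
        fix q assume "q \<in> topspace (subtopology T (sublevel t))"
        then have q: "q \<in> topspace T" "\<rho> q < t" by auto
        \<comment> \<open>The midpoint lies strictly between \<open>\<rho> q\<close> and
          \<open>t\<close>, so \<open>q\<close> already belongs to a strictly smaller open
          sublevel.\<close>
        then have "(\<rho> q + t) / 2 \<in> {0..<t}" "q \<in> sublevel ((\<rho> q + t) / 2)"
          using \<rho>_nonneg[of q] t(1) by auto
        then show "q \<in> (\<Union>r\<in>{0..<t}. sublevel r)" by (rule UN_I)
      qed
      fix r assume r: "r \<in> {0..<t}"
      then have sub: "sublevel r \<subseteq> sublevel t" by auto
      show "openin (subtopology T (sublevel t)) (sublevel r)"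
        using openin_sublevel sub by (simp add: openin_open_subtopology)
      have "continuous_map (subtopology T (closed_sublevel r)) X (\<sigma> r)"
        using \<sigma> r by (auto simp: L_def)
      moreover have "subtopology (subtopology T (sublevel t)) (sublevel r) = subtopology T (sublevel r)"
        using sub by (simp add: subtopology_subtopology inf_absorb2)
      moreover have "sublevel r \<subseteq> closed_sublevel r" by auto
      ultimately show "continuous_map (subtopology (subtopology T (sublevel t)) (sublevel r)) X (\<sigma> r)"
        using continuous_map_from_subtopology_mono by (simp only:) blast
      fix r' q assume "r' \<in> {0..<t}" "q \<in> topspace (subtopology T (sublevel t)) \<inter> sublevel r \<inter> sublevel r'"
      then show "\<sigma> r q = \<sigma> r' q" using r by (intro agree') auto
    qed (use that in blast)
    have \<tau>': "\<exists>r. 0 \<le> r \<and> r < t \<and> q \<in> closed_sublevel r \<and> \<tau> q = \<sigma> r q" if q: "q \<in> sublevel t" for q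
    proof -
      have "0 \<le> (\<rho> q + t) / 2" "(\<rho> q + t) / 2 < t" "q \<in> sublevel ((\<rho> q + t) / 2)"
        using \<rho>_nonneg[of q] t(1) q by auto
      then show ?thesis
        using \<tau>(2)[of "(\<rho> q + t) / 2" q] q by (intro exI[of _ "(\<rho> q + t) / 2"]) auto
    qed
    have f\<tau>: "f (\<tau> q) = g q" if q: "q \<in> sublevel t" for q
    proof -
      obtain r where "0 \<le> r" "r < t" "q \<in> closed_sublevel r" "\<tau> q = \<sigma> r q"
        using \<tau>'[OF q] by blast
      then show ?thesis using \<sigma>[of r] unfolding L_def by auto
    qed
    have \<tau>a: "\<tau> a = x0"
    proof -
      have "a \<in> sublevel t" using a_in(2)[of t] t(1) by simp
      then obtain r where "0 \<le> r" "r < t" "\<tau> a = \<sigma> r a"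
        using \<tau>' by blast
      then show ?thesis using \<sigma>[of r] unfolding L_def by simp
    qed
    show ?thesis
    proof (rule lift_extends_to_closed_sublevel[OF X Y f(1) g(1) fin \<tau>(1) f\<tau> t(1)])
      fix s' assume s': "continuous_map (subtopology T (closed_sublevel t)) X s'"
        "\<And>q. q \<in> closed_sublevel t \<Longrightarrow> f (s' q) = g q"
        "\<And>q. q \<in> sublevel t \<Longrightarrow> s' q = \<tau> q"
      have "a \<in> sublevel t" using a_in(2)[of t] t(1) by simp
      then have "s' a = x0" using s'(3) \<tau>a by simp
      then have "L t s'" unfolding L_def using s'(1,2) by simp
      then show "t \<in> A" unfolding A_def using t by (intro CollectI conjI exI[of _ s']) auto
    qed
  qed
  have bdd: "bdd_above A" unfolding A_def by (rule bdd_aboveI[of _ 1]) auto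
  define t where "t = Sup A"
  have "0 \<le> t"
    unfolding t_def by (rule cSup_upper[OF A0 bdd])
  moreover have "t \<le> 1"
    unfolding t_def by (rule cSup_least) (use A0 in \<open>auto simp only: A_def\<close>)
  ultimately have t: "0 \<le> t" "t \<le> 1" .
  \<comment> \<open>The limit step covers only positive parameters; one enlargement of the trivial
    lift over \<open>a\<close> shows that the supremum is positive.\<close>
  have "0 < t"
  proof -
    obtain t' where "t' \<in> A" "0 < t'" using enlarge[OF A0] by auto
    then show ?thesis using cSup_upper[OF _ bdd] unfolding t_def by force
  qed
  have "t \<in> A"
  proof (rule limit[OF \<open>0 < t\<close> t(2)])
    fix r assume r: "0 \<le> r" "r < t"
    then obtain t' where "t' \<in> A" "r < t'"
      using less_cSup_iff[of A r] A0 bdd unfolding t_def by blast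
    then show "r \<in> A" using down r by auto
  qed
  have "t = 1"
  proof (rule ccontr)
    assume "t \<noteq> 1"
    then obtain t' where "t' \<in> A" "t < t'" using enlarge[OF \<open>t \<in> A\<close>] t(2) by auto
    then show False using cSup_upper[OF _ bdd, of t'] unfolding t_def by simp
  qed
  then obtain s where "L 1 s" using \<open>t \<in> A\<close> unfolding A_def by blast
  moreover have "closed_sublevel 1 = topspace T" using \<rho>_le_1 by auto
  ultimately show thesis using that unfolding L_def by simp blast
qed

end

section \<open>Branched covers of compact spaces\<close>

text \<open>Openness of \<open>f\<close> supplies the continuity of the local inverse, which reduces
  branching to a failure of local injectivity.\<close>

lemma local_homeomorphism_at_iff_inj:
  assumes f: "continuous_map X Y f" "open_map X Y f"
  shows "local_homeomorphism_at X Y f x \<longleftrightarrow> (\<exists>U. openin X U \<and> x \<in> U \<and> inj_on f U)"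
proof
  assume "local_homeomorphism_at X Y f x"
  then obtain U where U: "openin X U" "x \<in> U"
      "homeomorphic_map (subtopology X U) (subtopology Y (f ` U)) f"
    unfolding local_homeomorphism_at_def by blast
  then have "inj_on f U"
    using homeomorphic_imp_injective_map[OF U(3)] openin_subset[OF U(1)] by (simp add: inf_absorb2)
  then show "\<exists>U. openin X U \<and> x \<in> U \<and> inj_on f U" using U by blast
next
  assume "\<exists>U. openin X U \<and> x \<in> U \<and> inj_on f U"
  then obtain U where U: "openin X U" "x \<in> U" "inj_on f U" by blast
  have fU: "openin Y (f ` U)" using f(2) U(1) by (simp add: open_map_def)
  have top: "topspace (subtopology X U) = U" "topspace (subtopology Y (f ` U)) = f ` U"
    using openin_subset[OF U(1)] openin_subset[OF fU] by (simp_all add: inf_absorb2)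
  have "homeomorphic_map (subtopology X U) (subtopology Y (f ` U)) f"
  proof (rule bijective_open_imp_homeomorphic_map)
    show "continuous_map (subtopology X U) (subtopology Y (f ` U)) f"
      using f(1) by (simp add: continuous_map_in_subtopology continuous_map_from_subtopology)
    show "open_map (subtopology X U) (subtopology Y (f ` U)) f"
      unfolding open_map_def
    proof (intro allI impI)
      fix V assume "openin (subtopology X U) V"
      then have "openin X V" "V \<subseteq> U"
        using U(1) openin_open_subtopology by blast+
      then show "openin (subtopology Y (f ` U)) (f ` V)"
        using f(2) fU by (auto simp: open_map_def openin_open_subtopology)
    qed
  qed (use U top in auto)
  then show "local_homeomorphism_at X Y f x"
    unfolding local_homeomorphism_at_def using U fU by blast
qed

lemma locally_constant_on_connectedin:
  assumes C: "connectedin X C"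
    and loc: "\<And>y. y \<in> C \<Longrightarrow> \<exists>V. openin X V \<and> y \<in> V \<and> (\<forall>z\<in>V. n z = n y)"
    and y: "y \<in> C" "z \<in> C"
  shows "n z = n y"
proof -
  have CX: "C \<subseteq> topspace X" using C connectedin_subset_topspace by blast
  have op: "openin (subtopology X C) {z \<in> C. P (n z)}" for P
  proof (subst openin_subopen, intro ballI)
    fix z assume z: "z \<in> {z \<in> C. P (n z)}"
    then obtain V where V: "openin X V" "z \<in> V" "\<forall>u\<in>V. n u = n z"
      using loc by blast
    then have "openin (subtopology X C) (V \<inter> C)"
      by (auto simp: openin_subtopology)
    moreover have "z \<in> V \<inter> C" using z V(2) by blast
    moreover have "V \<inter> C \<subseteq> {z \<in> C. P (n z)}"
    proof
      fix u assume "u \<in> V \<inter> C"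
      then have "u \<in> C" "n u = n z" using V(3) by blast+
      then show "u \<in> {z \<in> C. P (n z)}" using z by simp
    qed
    ultimately show "\<exists>T. openin (subtopology X C) T \<and> z \<in> T \<and> T \<subseteq> {z \<in> C. P (n z)}" by (intro exI[of _ "V \<inter> C"] conjI)
  qed
  have top: "topspace (subtopology X C) = C" using CX by (simp add: inf_absorb2)
  have "openin (subtopology X C) {z \<in> C. n z = n y}" by (rule op)
  moreover have "closedin (subtopology X C) {z \<in> C. n z = n y}"
  proof -
    have "C - {z \<in> C. n z = n y} = {z \<in> C. n z \<noteq> n y}" by blast
    then show ?thesis
      unfolding closedin_def top using op[of "\<lambda>k. k \<noteq> n y"] by auto
  qed
  ultimately have "{z \<in> C. n z = n y} = C"
    using C y(1) top unfolding connectedin_def connected_space_clopen_in by blast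
  then show ?thesis using y by blast
qed

locale compact_branched_cover =
  fixes M :: "'a topology" and f :: "'a \<Rightarrow> 'a"
  assumes compact: "compact_space M" and Hausdorff: "Hausdorff_space M"
    and branched: "branched_cover M M f"
begin

abbreviation fibre where "fibre y \<equiv> {x \<in> topspace M. f x = y}"
abbreviation "B\<^sub>f \<equiv> branch_set M f"

lemma continuous_f: "continuous_map M M f"
  and open_f: "open_map M M f"
  using branched by (auto simp: branched_cover_def)

lemma closed_f: "closed_map M M f"
  using continuous_imp_closed_map[OF continuous_f compact Hausdorff] .

lemma f_mem: "x \<in> topspace M \<Longrightarrow> f x \<in> topspace M"
  using continuous_map_funspace[OF continuous_f] by blast

lemma openin_preimage: "openin M V \<Longrightarrow> openin M {x \<in> topspace M. f x \<in> V}"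
  using openin_continuous_map_preimage[OF continuous_f] .

lemma openin_image: "openin M U \<Longrightarrow> openin M (f ` U)"
  using open_f by (simp add: open_map_def)

text \<open>A fibre is closed in a compact space, hence compact, and it is discrete.\<close>

lemma finite_fibre: "finite (fibre y)"
proof (cases "y \<in> topspace M")
  case True
  have "closedin M {y}"
    using Hausdorff True closedin_Hausdorff_singleton by metis
  then have "closedin M (fibre y)"
    using closedin_continuous_map_preimage[OF continuous_f, of "{y}"] by simp
  then have "compact_space (subtopology M (fibre y))"
    using compact closedin_compact_space compact_space_subtopology by blast
  moreover have "subtopology M (fibre y) = discrete_topology (fibre y)"
    using branched True by (simp add: branched_cover_def Let_def)
  ultimately show ?thesis
    by (metis compact_space_discrete_topology)
next
  case False
  then have "fibre y = {}" using f_mem by auto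
  then show ?thesis by (simp only: finite.emptyI)
qed

text \<open>Here \<open>\<pi>\<close> sends a point of a nearby fibre to the point of \<open>fibre y\<close> whose neighbourhood contains
  it, so all comparisons of fibre cardinalities reduce to \<open>\<pi>\<close> being onto or injective.\<close>

lemma fibre_projection:
  assumes y: "y \<in> topspace M" and U: "\<And>x. x \<in> fibre y \<Longrightarrow> openin M (U x) \<and> x \<in> U x"
  obtains N V \<pi> where "openin M V" "y \<in> V"
    "\<And>x. x \<in> fibre y \<Longrightarrow> openin M (N x) \<and> x \<in> N x \<and> N x \<subseteq> U x"
    "\<And>z. z \<in> V \<Longrightarrow> \<pi> ` fibre z = fibre y"
    "\<And>u. \<lbrakk>u \<in> topspace M; f u \<in> V\<rbrakk> \<Longrightarrow> u \<in> N (\<pi> u)"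
    "\<And>x u. \<lbrakk>x \<in> fibre y; u \<in> N x; f u \<in> V\<rbrakk> \<Longrightarrow> \<pi> u = x"
proof -
  let ?F = "fibre y"
  obtain N0 where N0: "\<And>x. x \<in> ?F \<Longrightarrow> openin M (N0 x) \<and> x \<in> N0 x"
      "\<And>x x'. \<lbrakk>x \<in> ?F; x' \<in> ?F; x \<noteq> x'\<rbrakk> \<Longrightarrow> N0 x \<inter> N0 x' = {}"
    using finite_disjoint_neighbourhoods[OF Hausdorff finite_fibre[of y]]
    by (metis (no_types, lifting) mem_Collect_eq subsetI)
  define N where "N x = N0 x \<inter> U x" for x
  have N: "openin M (N x)" "x \<in> N x" "N x \<subseteq> U x" if "x \<in> ?F" for x
    using N0(1)[OF that] U[OF that] by (auto simp: N_def)
  have N_disj: "x = x'" if "x \<in> ?F" "x' \<in> ?F" "u \<in> N x" "u \<in> N x'" for x x' u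
    using N0(2)[of x x'] that by (auto simp: N_def)
  let ?K = "topspace M - \<Union>(N ` ?F)"
  have "closedin M ?K" using N(1) by (intro closedin_diff openin_Union) auto
  then have "closedin M (f ` ?K)" using closed_f by (simp add: closed_map_def)
  \<comment> \<open>Avoiding the image of \<open>?K\<close> puts every point over \<open>V\<close>
    into some \<open>N x\<close>; lying in every image of an \<open>N x\<close> makes \<pi> onto.
    The inserted \<open>topspace M\<close> covers an empty fibre.\<close>
  define V where "V = (topspace M - f ` ?K) \<inter> \<Inter>(insert (topspace M) ((\<lambda>x. f ` N x) ` ?F))"
  have "openin M (\<Inter>(insert (topspace M) ((\<lambda>x. f ` N x) ` ?F)))"
    using finite_fibre openin_image N(1) by (intro openin_Inter) auto
  then have V: "openin M V"
    unfolding V_def using \<open>closedin M (f ` ?K)\<close> by (intro openin_Int) auto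
  have "y \<notin> f ` ?K" using N(2) by fastforce
  moreover have "y \<in> f ` N x" if "x \<in> ?F" for x
    using N(2)[OF that] that by blast
  ultimately have yV: "y \<in> V" using y by (auto simp: V_def)
  define \<pi> where "\<pi> u = (SOME x. x \<in> ?F \<and> u \<in> N x)" for u
  have \<pi>: "\<pi> u \<in> ?F \<and> u \<in> N (\<pi> u)" if "u \<in> topspace M" "f u \<in> V" for u
  proof -
    have "\<exists>x. x \<in> ?F \<and> u \<in> N x" using that by (auto simp: V_def)
    then show ?thesis unfolding \<pi>_def by (rule someI_ex)
  qed
  have \<pi>_eq: "\<pi> u = x" if x: "x \<in> ?F" "u \<in> N x" "f u \<in> V" for x u
  proof -
    have "u \<in> topspace M" using openin_subset[OF N(1)[OF x(1)]] x(2) by blast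
    then show ?thesis using \<pi>[of u] N_disj[of x "\<pi> u" u] x by blast
  qed
  have \<pi>_onto: "\<pi> ` fibre z = ?F" if z: "z \<in> V" for z
  proof
    show "\<pi> ` fibre z \<subseteq> ?F" using \<pi> z by blast
    show "?F \<subseteq> \<pi> ` fibre z"
    proof
      fix x assume x: "x \<in> ?F"
      then have "z \<in> f ` N x" using z unfolding V_def by blast
      then obtain u where u: "u \<in> N x" "z = f u" by blast
      moreover have "u \<in> topspace M" using openin_subset[OF N(1)[OF x]] u(1) by blast
      ultimately have "u \<in> fibre z" by blast
      moreover have "\<pi> u = x" using \<pi>_eq[OF x u(1)] z u(2) by blast
      ultimately show "x \<in> \<pi> ` fibre z" by blast
    qed
  qed
  show thesis
  proof (rule that[of V N \<pi>])
    fix x assume "x \<in> ?F"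
    then show "openin M (N x) \<and> x \<in> N x \<and> N x \<subseteq> U x" using N by blast
  next
    fix u assume "u \<in> topspace M" "f u \<in> V"
    then show "u \<in> N (\<pi> u)" using \<pi> by blast
  qed (fact V yV \<pi>_onto \<pi>_eq)+
qed

section \<open>Fibre cardinality and the values of branch points\<close>

lemma card_fibre_lower_semicontinuous:
  assumes y: "y \<in> topspace M"
  obtains V where "openin M V" "y \<in> V" "\<And>z. z \<in> V \<Longrightarrow> card (fibre y) \<le> card (fibre z)"
proof (rule fibre_projection[OF y, of "\<lambda>_. topspace M"])
  fix V N and \<pi> :: "'a \<Rightarrow> 'a"
  assume V: "openin M V" "y \<in> V" and \<pi>: "\<And>z. z \<in> V \<Longrightarrow> \<pi> ` fibre z = fibre y"
  have "card (fibre y) \<le> card (fibre z)" if "z \<in> V" for z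
    using card_image_le[OF finite_fibre, of \<pi> z] \<pi>[OF that] by simp
  then show thesis by (rule that[OF V])
qed auto

lemma branch_point_iff:
  "x \<in> B\<^sub>f \<longleftrightarrow> x \<in> topspace M \<and> \<not> (\<exists>U. openin M U \<and> x \<in> U \<and> inj_on f U)"
  unfolding branch_set_def local_homeomorphism_at_iff_inj[OF continuous_f open_f] by simp

lemma closedin_branch_set: "closedin M B\<^sub>f"
proof -
  have "topspace M - B\<^sub>f = \<Union>{U. openin M U \<and> inj_on f U}"
    using openin_subset by (fastforce simp: branch_point_iff)
  then have "openin M (topspace M - B\<^sub>f)" by auto
  then show ?thesis
    by (auto simp: closedin_def branch_point_iff)
qed

text \<open>At a local maximum of the cardinality, \<pi> maps nearby fibres onto a set at least as
  large, hence injectively. So each \<open>N x\<close> meets each of these fibres at most once, and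
  \<open>f\<close> is injective near \<open>x\<close>.\<close>

lemma not_branch_value_if_card_fibre_max:
  assumes y: "y \<in> topspace M" and W: "openin M W" "y \<in> W"
    and max: "\<And>z. z \<in> W \<Longrightarrow> card (fibre z) \<le> card (fibre y)"
  shows "y \<notin> f ` B\<^sub>f"
proof (rule fibre_projection[OF y, of "\<lambda>_. topspace M"])
  fix V N and \<pi> :: "'a \<Rightarrow> 'a"
  assume V: "openin M V" "y \<in> V"
    and N: "\<And>x. x \<in> fibre y \<Longrightarrow> openin M (N x) \<and> x \<in> N x \<and> N x \<subseteq> topspace M"
    and onto: "\<And>z. z \<in> V \<Longrightarrow> \<pi> ` fibre z = fibre y"
    and \<pi>_eq: "\<And>x u. \<lbrakk>x \<in> fibre y; u \<in> N x; f u \<in> V\<rbrakk> \<Longrightarrow> \<pi> u = x"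
  show "y \<notin> f ` B\<^sub>f"
  proof
    assume "y \<in> f ` B\<^sub>f"
    then obtain x where x: "x \<in> B\<^sub>f" "y = f x" by blast
    then have xF: "x \<in> fibre y" by (simp add: branch_point_iff)
    let ?U = "N x \<inter> {u \<in> topspace M. f u \<in> V \<inter> W}"
    have "openin M ?U" using N[OF xF] openin_preimage[of "V \<inter> W"] V(1) W(1) by blast
    moreover have "x \<in> ?U" using N[OF xF] xF V(2) W(2) by simp
    moreover have "inj_on f ?U"
    proof (rule inj_onI)
      fix u v assume u: "u \<in> ?U" and v: "v \<in> ?U" and uv: "f u = f v"
      let ?z = "f u"
      have z: "?z \<in> V" "?z \<in> W" using u by auto
      have "card (\<pi> ` fibre ?z) = card (fibre ?z)"
        using onto[OF z(1)] max[OF z(2)] card_image_le[OF finite_fibre, of \<pi> ?z] by simp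
      then have "inj_on \<pi> (fibre ?z)" by (rule eq_card_imp_inj_on[OF finite_fibre])
      moreover have "\<pi> u = x" "\<pi> v = x" using \<pi>_eq[OF xF] u v by auto
      moreover have "u \<in> fibre ?z" "v \<in> fibre ?z" using u v uv by auto
      ultimately show "u = v" by (simp only: inj_on_def)
    qed
    ultimately show False using x(1) unfolding branch_point_iff by blast
  qed
qed auto

text \<open>With neighbourhoods on which \<open>f\<close> is injective, two points of a nearby fibre
  cannot have the same image under \<pi>, which is therefore a bijection.\<close>

lemma card_fibre_locally_constant:
  assumes y: "y \<in> topspace M" "y \<notin> f ` B\<^sub>f"
  shows "\<exists>V. openin M V \<and> y \<in> V \<and> (\<forall>z\<in>V. card (fibre z) = card (fibre y))"
proof -
  have "\<exists>U. openin M U \<and> x \<in> U \<and> inj_on f U" if "x \<in> fibre y" for x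
  proof -
    have "x \<notin> B\<^sub>f" using y(2) that by blast
    then show ?thesis using that unfolding branch_point_iff by blast
  qed
  then obtain U where U: "\<And>x. x \<in> fibre y \<Longrightarrow> openin M (U x) \<and> x \<in> U x \<and> inj_on f (U x)"
    by metis
  show ?thesis
  proof (rule fibre_projection[OF y(1), of U])
    fix V N and \<pi> :: "'a \<Rightarrow> 'a"
    assume V: "openin M V" "y \<in> V"
      and N: "\<And>x. x \<in> fibre y \<Longrightarrow> openin M (N x) \<and> x \<in> N x \<and> N x \<subseteq> U x"
      and onto: "\<And>z. z \<in> V \<Longrightarrow> \<pi> ` fibre z = fibre y"
      and mem: "\<And>u. \<lbrakk>u \<in> topspace M; f u \<in> V\<rbrakk> \<Longrightarrow> u \<in> N (\<pi> u)"
    have "card (fibre z) = card (fibre y)" if z: "z \<in> V" for z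
    proof -
      have "inj_on \<pi> (fibre z)"
      proof (rule inj_onI)
        fix u v assume u: "u \<in> fibre z" and v: "v \<in> fibre z" and uv: "\<pi> u = \<pi> v"
        have F: "\<pi> u \<in> fibre y" using onto[OF z] u by blast
        have "u \<in> N (\<pi> u)" by (rule mem) (use u z in auto)
        moreover have "v \<in> N (\<pi> u)" unfolding uv by (rule mem) (use v z in auto)
        ultimately have "u \<in> N (\<pi> u)" "v \<in> N (\<pi> u)" .
        then have "u \<in> U (\<pi> u)" "v \<in> U (\<pi> u)" using N[OF F] by blast+
        then show "u = v" using U[OF F] u v by (auto dest: inj_onD)
      qed
      then have "card (\<pi> ` fibre z) = card (fibre z)" by (rule card_image)
      then show ?thesis by (simp only: onto[OF z])
    qed
    then show ?thesis using V by blast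
  qed (use U in blast)
qed

text \<open>Semicontinuity makes the set \<open>C k\<close> of branch values with at most
  \<open>k\<close> preimages closed. Inside an open subset the bounded cardinality would attain a
  maximum, at a point that cannot be a branch value. So each \<open>C k\<close> has empty interior,
  and Baire's theorem passes this to the union.\<close>

lemma interior_of_branch_values: "M interior_of (f ` B\<^sub>f) = {}"
proof -
  define C where "C k = {y \<in> f ` B\<^sub>f. card (fibre y) \<le> k}" for k
  have fB: "closedin M (f ` B\<^sub>f)"
    using closed_f closedin_branch_set by (simp add: closed_map_def)
  have C_closed: "closedin M (C k)" for k
  proof -
    have "openin M {y \<in> topspace M. k < card (fibre y)}"
    proof (subst openin_subopen, intro ballI)
      fix y assume y: "y \<in> {y \<in> topspace M. k < card (fibre y)}"
      then obtain V where V: "openin M V" "y \<in> V" "\<And>z. z \<in> V \<Longrightarrow> card (fibre y) \<le> card (fibre z)"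
        using card_fibre_lower_semicontinuous[of y] by blast
      have "V \<subseteq> {y \<in> topspace M. k < card (fibre y)}"
      proof
        fix z assume z: "z \<in> V"
        then have "z \<in> topspace M" using openin_subset[OF V(1)] by blast
        moreover have "k < card (fibre z)" using y V(3)[OF z] by simp
        ultimately show "z \<in> {y \<in> topspace M. k < card (fibre y)}" by simp
      qed
      then show "\<exists>T. openin M T \<and> y \<in> T \<and> T \<subseteq> {y \<in> topspace M. k < card (fibre y)}"
        using V by blast
    qed
    moreover have "C k = f ` B\<^sub>f - {y \<in> topspace M. k < card (fibre y)}"
      using closedin_subset[OF fB] by (auto simp: C_def)
    ultimately show ?thesis using fB by (simp add: closedin_diff)
  qed
  have C_interior: "M interior_of (C k) = {}" for k
  proof (rule ccontr)
    let ?W = "M interior_of (C k)"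
    assume "?W \<noteq> {}"
    then obtain w where w: "w \<in> ?W" by blast
    have bound: "\<forall>z. z \<in> ?W \<longrightarrow> card (fibre z) \<le> k"
      using interior_of_subset[of M "C k"] unfolding C_def by blast
    obtain y where y: "y \<in> ?W" "\<And>z. z \<in> ?W \<Longrightarrow> card (fibre z) \<le> card (fibre y)"
    proof -
      have "\<forall>z. z \<in> ?W \<longrightarrow> card (fibre z) < Suc k" using bound by (simp add: less_Suc_eq_le)
      then have "\<exists>y. y \<in> ?W \<and> (\<forall>z. z \<in> ?W \<longrightarrow> card (fibre z) \<le> card (fibre y))"
        by (rule Lattices_Big.ex_has_greatest_nat[of "\<lambda>z. z \<in> ?W", OF w])
      then show thesis using that by (elim exE conjE) simp
    qed
    have "y \<in> C k" using y(1) interior_of_subset[of M "C k"] by blast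
    moreover have "y \<notin> f ` B\<^sub>f"
    proof (rule not_branch_value_if_card_fibre_max[OF _ openin_interior_of y])
      show "y \<in> topspace M" using y(1) interior_of_subset_topspace[of M] by blast
    qed
    ultimately show False by (simp add: C_def)
  qed
  have "M interior_of \<Union>(range C) = {}"
  proof (rule Baire_category_alt)
    show "completely_metrizable_space M \<or> locally_compact_space M \<and> regular_space M"
      using compact Hausdorff compact_imp_locally_compact_space compact_Hausdorff_imp_regular_space
      by blast
  qed (use C_closed C_interior in auto)
  moreover have "\<Union>(range C) = f ` B\<^sub>f" by (auto simp: C_def)
  ultimately show ?thesis by simp
qed

text \<open>Every point has nearby values outside the nowhere dense set of branch values, where the
  cardinality is one of finitely many constants; semicontinuity bounds the fibre at the point by one
  of them.\<close>

lemma card_fibre_bounded: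
  assumes fin: "finite \<C>" and conn: "\<And>C. C \<in> \<C> \<Longrightarrow> connectedin M C"
    and cover: "\<Union>\<C> = topspace M - f ` B\<^sub>f"
  obtains k where "\<And>y. card (fibre y) \<le> k"
proof -
  have "\<exists>k. \<forall>y\<in>C. card (fibre y) = k" if C: "C \<in> \<C>" for C
  proof (cases "C = {}")
    case False
    then obtain y where y: "y \<in> C" by blast
    have "card (fibre z) = card (fibre y)" if "z \<in> C" for z
    proof (rule locally_constant_on_connectedin[OF conn[OF C] _ y that, where n = "\<lambda>y. card (fibre y)"])
      fix y assume "y \<in> C"
      then have "y \<in> topspace M" "y \<notin> f ` B\<^sub>f" using cover C by blast+
      then show "\<exists>V. openin M V \<and> y \<in> V \<and> (\<forall>z\<in>V. card (fibre z) = card (fibre y))"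
        by (rule card_fibre_locally_constant)
    qed
    then show ?thesis by blast
  qed auto
  then obtain \<kappa> where \<kappa>: "\<And>C y. \<lbrakk>C \<in> \<C>; y \<in> C\<rbrakk> \<Longrightarrow> card (fibre y) = \<kappa> C"
    by metis
  \<comment> \<open>The sum serves merely as a common upper bound for the finitely many
    constants.\<close>
  have "card (fibre y) \<le> sum \<kappa> \<C>" for y
  proof (cases "y \<in> topspace M")
    case True
    obtain V where V: "openin M V" "y \<in> V" "\<And>z. z \<in> V \<Longrightarrow> card (fibre y) \<le> card (fibre z)"
      using card_fibre_lower_semicontinuous[OF True] by blast
    have "\<not> V \<subseteq> f ` B\<^sub>f"
      using interior_of_branch_values V(1,2) interior_of_maximal by blast
    then obtain z where z: "z \<in> V" "z \<in> \<Union>\<C>"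
      using cover openin_subset[OF V(1)] by blast
    then obtain C where C: "C \<in> \<C>" "z \<in> C" by blast
    have "card (fibre y) \<le> \<kappa> C" using V(3)[OF z(1)] \<kappa>[OF C] by simp
    also have "\<dots> \<le> sum \<kappa> \<C>" using member_le_sum[OF C(1), of \<kappa>] fin by simp
    finally show ?thesis .
  next
    case False
    then have "fibre y = {}" using f_mem by auto
    then show ?thesis by (simp only: card.empty)
  qed
  then show thesis by (rule that)
qed

section \<open>Local index and injectivity along a branch cell\<close>

lemma local_index_finite:
  assumes k: "\<And>y. card (fibre y) \<le> k" and x: "x \<in> topspace M"
  shows "local_index M f x \<le> enat k"
proof -
  have "max_multiplicity f (topspace M) \<le> enat k"
    unfolding max_multiplicity_def
  proof (rule SUP_least)
    fix y
    have "f -` {y} \<inter> topspace M = fibre y" by auto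
    then show "ecard (f -` {y} \<inter> topspace M) \<le> enat k"
      using k[of y] finite_fibre[of y] by (simp add: ecard_def)
  qed
  then show ?thesis
    unfolding local_index_def using x by (intro INF_lower2[of "topspace M"]) auto
qed

lemma locally_injective_over_constant_index:
  assumes b: "b \<subseteq> topspace M" and hom: "homeomorphic_map (subtopology M b) (subtopology M (f ` b)) f"
    and I: "I \<subseteq> f ` b"
    and index: "\<And>x. \<lbrakk>x \<in> b; f x \<in> I\<rbrakk> \<Longrightarrow> local_index M f x = enat m"
    and x: "x \<in> b" "f x \<in> I"
  shows "\<exists>U. openin M U \<and> x \<in> U \<and> inj_on f (U \<inter> f -` I)"
proof -
  obtain U0 where U0: "openin M U0" "x \<in> U0" "max_multiplicity f U0 \<le> enat m"
  proof -
    have "\<exists>U. openin M U \<and> x \<in> U \<and> max_multiplicity f U \<le> enat m"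
    proof (rule ccontr)
      assume "\<not> ?thesis"
      \<comment> \<open>Were every multiplicity larger than \<open>m\<close>, the infimum would be
        at least m + 1; so some neighbourhood attains it.\<close>
      then have "eSuc (enat m) \<le> max_multiplicity f U" if "openin M U" "x \<in> U" for U
        using that by (meson ileI1 not_le)
      then have "eSuc (enat m) \<le> local_index M f x"
        unfolding local_index_def by (intro INF_greatest) auto
      then show False using index[OF x] by (simp add: eSuc_enat)
    qed
    then show thesis using that by blast
  qed
  \<comment> \<open>A second preimage in \<open>U0\<close> of a point of \<open>I\<close> would contribute one more sheet on top of the \<open>m\<close>
     sheets meeting at the preimage in \<open>b\<close>.\<close>
  have unique: "z = w" if z: "z \<in> U0" and w: "w \<in> U0" "w \<in> b" and eq: "f z = f w" and wI: "f w \<in> I" for z w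
  proof (rule ccontr)
    assume "z \<noteq> w"
    moreover have "z \<in> topspace M" "w \<in> topspace M" using z w openin_subset[OF U0(1)] by blast+
    ultimately obtain A A' where A: "openin M A" "openin M A'" "w \<in> A" "z \<in> A'" "disjnt A A'"
      using Hausdorff unfolding Hausdorff_space_def by metis
    \<comment> \<open>\<open>S\<close> consists of the points near \<open>w\<close> whose value is
      also taken near \<open>z\<close>. It is an open neighbourhood of \<open>w\<close>, since
      \<open>f\<close> is open and takes equal values at \<open>z\<close> and \<open>w\<close>. The
      witness in \<open>A'\<close> is counted in \<open>U0\<close> but not in
      \<open>S\<close>.\<close>
    define S where "S = (A \<inter> U0) \<inter> {u \<in> topspace M. f u \<in> f ` (A' \<inter> U0)}"
    have "openin M S"
      unfolding S_def using A U0(1) by (intro openin_Int openin_preimage openin_image) auto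
    moreover have wS: "w \<in> S"
      using A w z eq \<open>w \<in> topspace M\<close> unfolding S_def by (auto intro!: image_eqI[of _ f z])
    ultimately have "local_index M f w \<le> max_multiplicity f S"
      unfolding local_index_def by (intro INF_lower) auto
    then have m_le: "enat m \<le> max_multiplicity f S" using index[OF w(2) wI] by simp
    have step: "eSuc (ecard (f -` {y} \<inter> S)) \<le> enat m" if y: "y \<in> f ` S" for y
    proof -
      obtain z0 where z0: "z0 \<in> A'" "z0 \<in> U0" "f z0 = y"
        using y unfolding S_def by force
      have "z0 \<notin> S" using A(5) z0(1) unfolding S_def disjnt_iff by blast
      moreover have "insert z0 (f -` {y} \<inter> S) \<subseteq> f -` {y} \<inter> U0"
        using z0 unfolding S_def by blast
      ultimately have "eSuc (ecard (f -` {y} \<inter> S)) \<le> ecard (f -` {y} \<inter> U0)"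
        using card_mono[of "f -` {y} \<inter> U0" "insert z0 (f -` {y} \<inter> S)"]
          finite_subset[of "insert z0 (f -` {y} \<inter> S)" "f -` {y} \<inter> U0"]
        by (auto simp: ecard_def eSuc_enat)
      also have "\<dots> \<le> max_multiplicity f U0"
        unfolding max_multiplicity_def using z0 by (intro SUP_upper) auto
      finally show ?thesis using U0(3) by (rule order_trans)
    qed
    \<comment> \<open>Subtraction of naturals truncates, so the bound \<open>m - 1\<close> below is
      strict only because \<open>m\<close> is positive.\<close>
    have "0 < m"
    proof -
      have "eSuc (ecard (f -` {f w} \<inter> S)) \<le> enat m" using step wS by blast
      then show ?thesis by (metis gr0I eSuc_ne_0 zero_enat_def le_zero_eq)
    qed
    have "max_multiplicity f S \<le> enat (m - 1)"
      unfolding max_multiplicity_def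
    proof (rule SUP_least)
      fix y assume "y \<in> f ` S"
      then have "eSuc (ecard (f -` {y} \<inter> S)) \<le> eSuc (enat (m - 1))"
        using step \<open>0 < m\<close> by (simp add: eSuc_enat)
      then show "ecard (f -` {y} \<inter> S) \<le> enat (m - 1)" by simp
    qed
    then have "enat m \<le> enat (m - 1)" using m_le by (rule order_trans[rotated])
    then show False using \<open>0 < m\<close> by simp
  qed
  obtain h where h: "homeomorphic_maps (subtopology M b) (subtopology M (f ` b)) f h"
    using hom homeomorphic_map_maps[THEN iffD1] by blast
  have top: "topspace (subtopology M b) = b" "topspace (subtopology M (f ` b)) = f ` b"
    using b f_mem by (auto simp: inf_absorb2)
  have hc: "continuous_map (subtopology M (f ` b)) (subtopology M b) h"
    and hf: "\<And>u. u \<in> b \<Longrightarrow> h (f u) = u" and fh: "\<And>y. y \<in> f ` b \<Longrightarrow> f (h y) = y"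
    using h unfolding homeomorphic_maps_def top by auto
  have hb: "h y \<in> b" if "y \<in> f ` b" for y
    using continuous_map_funspace[OF hc] that unfolding top by blast
  have "openin (subtopology M b) (U0 \<inter> b)"
    using U0(1) by (auto simp: openin_subtopology)
  then have "openin (subtopology M (f ` b)) {y \<in> f ` b. h y \<in> U0 \<inter> b}"
    using openin_continuous_map_preimage[OF hc] unfolding top by blast
  then obtain V where V: "openin M V" "{y \<in> f ` b. h y \<in> U0 \<inter> b} = V \<inter> f ` b"
    by (auto simp: openin_subtopology)
  \<comment> \<open>For \<open>z\<close> in this set over \<open>I\<close>, the point
    \<open>h (f z)\<close> of \<open>b\<close> also lies in \<open>U0\<close>, so
    \<open>unique\<close> identifies it with \<open>z\<close>. Thus \<open>h\<close> is a left
    inverse of \<open>f\<close> there.\<close>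
  let ?U = "U0 \<inter> {u \<in> topspace M. f u \<in> V}"
  have "openin M ?U" using U0(1) openin_preimage[OF V(1)] by blast
  moreover have "x \<in> ?U"
  proof -
    have "f x \<in> {y \<in> f ` b. h y \<in> U0 \<inter> b}" using x(1) hf U0(2) by simp
    then have "f x \<in> V" using V(2) by blast
    then show ?thesis using U0(2) x(1) b by blast
  qed
  moreover have "inj_on f (?U \<inter> f -` I)"
  proof (rule inj_onI)
    have *: "z = h (f z)" if z: "z \<in> ?U \<inter> f -` I" for z
    proof (rule unique)
      have "f z \<in> V \<inter> f ` b" using z I by blast
      then have "f z \<in> {y \<in> f ` b. h y \<in> U0 \<inter> b}" using V(2) by blast
      then show "h (f z) \<in> U0" "h (f z) \<in> b" "f z = f (h (f z))" "f (h (f z)) \<in> I"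
        using fh z by auto
    qed (use z in blast)
    fix z z' assume "z \<in> ?U \<inter> f -` I" "z' \<in> ?U \<inter> f -` I" "f z = f z'"
    then show "z = z'" using *[of z] *[of z'] by simp
  qed
  ultimately show ?thesis by blast
qed

end

section \<open>Cells and their lifts\<close>

lemma cell_chart_subtopology:
  "c \<subseteq> S \<Longrightarrow> cell_chart (subtopology X S) k c h \<longleftrightarrow> cell_chart X k c h"
  by (simp add: cell_chart_def subtopology_subtopology inf_absorb2)

lemma cell_boundary_subtopology:
  "c \<subseteq> S \<Longrightarrow> cell_boundary (subtopology X S) c = cell_boundary X c"
  by (simp add: cell_boundary_def cell_chart_subtopology)

lemma cell_interior_subtopology:
  "c \<subseteq> S \<Longrightarrow> cell_interior (subtopology X S) c = cell_interior X c"
  by (simp add: cell_interior_def cell_boundary_subtopology)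

lemma is_cell_subtopology:
  "c \<subseteq> S \<Longrightarrow> is_cell (subtopology X S) c \<longleftrightarrow> is_cell X c"
  by (auto simp: is_cell_def cell_chart_subtopology)

lemma cell_interior_subset: "cell_interior X c \<subseteq> c"
  by (auto simp: cell_interior_def)

lemma cell_boundary_eq: "cell_boundary X c = c - cell_interior X c"
  by (auto simp: cell_interior_def cell_boundary_def)

lemma cell_interior_has_gauge:
  assumes c: "is_cell X c" and y: "y \<in> cell_interior X c"
  obtains T :: "(nat \<Rightarrow> real) topology" and a \<rho> h g
  where "star_gauge T a \<rho>" "homeomorphic_maps (subtopology X c) T h g" "g a = y"
    "g ` {q \<in> topspace T. \<rho> q < 1} = cell_interior X c"
proof -
  obtain k h where cX: "c \<subseteq> topspace X" and chart: "cell_chart X k c h"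
    using c by (auto simp: is_cell_def)
  let ?T = "subtopology (Euclidean_space k) (unit_cube k)"
  have int: "cell_interior X c = {x \<in> c. h x \<in> open_unit_cube k}"
    by (rule cell_interior_chart[OF chart cX])
  obtain \<rho> where \<rho>: "star_gauge ?T (h y) \<rho>"
    "\<And>q. q \<in> unit_cube k \<Longrightarrow> \<rho> q < 1 \<longleftrightarrow> q \<in> open_unit_cube k"
    using cube_star_gauge[of "h y" k] y int by blast
  obtain g where g: "homeomorphic_maps (subtopology X c) ?T h g"
    using chart homeomorphic_map_maps[THEN iffD1] unfolding cell_chart_def by blast
  have top: "topspace ?T = unit_cube k" "topspace (subtopology X c) = c"
    using unit_cube_subset cX by (simp_all add: inf_absorb2)
  have gh: "\<And>x. x \<in> c \<Longrightarrow> g (h x) = x" and hg: "\<And>q. q \<in> unit_cube k \<Longrightarrow> h (g q) = q"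
    using g unfolding homeomorphic_maps_def top by blast+
  have "h \<in> c \<rightarrow> unit_cube k" "g \<in> unit_cube k \<rightarrow> c"
    using g continuous_map_funspace[of "subtopology X c" ?T h] continuous_map_funspace[of ?T "subtopology X c" g]
    unfolding homeomorphic_maps_def top by blast+
  then have h: "\<And>x. x \<in> c \<Longrightarrow> h x \<in> unit_cube k" and gc: "\<And>q. q \<in> unit_cube k \<Longrightarrow> g q \<in> c"
    by (simp_all add: Pi_iff)
  have "g ` {q \<in> topspace ?T. \<rho> q < 1} = cell_interior X c"
  proof (intro equalityI subsetI)
    fix x assume "x \<in> g ` {q \<in> topspace ?T. \<rho> q < 1}"
    then show "x \<in> cell_interior X c"
      unfolding int top using \<rho>(2) hg gc by auto
  next
    fix x assume x: "x \<in> cell_interior X c"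
    then have "x = g (h x)" "h x \<in> {q \<in> topspace ?T. \<rho> q < 1}"
      unfolding int top using \<rho>(2) gh h by auto
    then show "x \<in> g ` {q \<in> topspace ?T. \<rho> q < 1}" by (rule image_eqI)
  qed
  moreover have "g (h y) = y" by (rule gh) (use y int in blast)
  ultimately show thesis by (intro that[OF \<rho>(1) g])
qed

lemma cell_interior_nonempty:
  assumes c: "is_cell X c" shows "cell_interior X c \<noteq> {}"
proof -
  obtain k h where cX: "c \<subseteq> topspace X" and chart: "cell_chart X k c h"
    using c by (auto simp: is_cell_def)
  have "open_unit_cube k \<subseteq> h ` c"
    using cell_chart_image[OF chart cX] open_unit_cube_subset by simp
  then obtain x where "x \<in> c" "h x \<in> open_unit_cube k"
    using open_unit_cube_nonempty by (metis (no_types, lifting) imageE subsetD)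
  then show ?thesis using cell_interior_chart[OF chart cX] by blast
qed

lemma connectedin_cell_interior:
  assumes c: "is_cell X c" shows "connectedin X (cell_interior X c)"
proof -
  obtain y where y: "y \<in> cell_interior X c" using cell_interior_nonempty[OF c] by blast
  obtain T :: "(nat \<Rightarrow> real) topology" and a \<rho> h g
    where T: "star_gauge T a \<rho>" "homeomorphic_maps (subtopology X c) T h g" "g a = y"
      "g ` {q \<in> topspace T. \<rho> q < 1} = cell_interior X c"
    by (rule cell_interior_has_gauge[OF c y])
  have "connectedin T {q \<in> topspace T. \<rho> q < 1}"
    using star_gauge.connectedin_sublevel[OF T(1)] by simp
  then have "connectedin (subtopology X c) (cell_interior X c)"
    using connectedin_continuous_map_image[of T "subtopology X c" g "{q \<in> topspace T. \<rho> q < 1}"] T(2,4)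
    unfolding homeomorphic_maps_def by simp
  then show ?thesis by (simp add: connectedin_subtopology)
qed

lemma cell_subset_closure_of_interior:
  assumes c: "is_cell X c" shows "c \<subseteq> X closure_of cell_interior X c"
proof -
  obtain y where y: "y \<in> cell_interior X c" using cell_interior_nonempty[OF c] by blast
  obtain T :: "(nat \<Rightarrow> real) topology" and a \<rho> h g
    where T: "star_gauge T a \<rho>" "homeomorphic_maps (subtopology X c) T h g" "g a = y"
      "g ` {q \<in> topspace T. \<rho> q < 1} = cell_interior X c"
    by (rule cell_interior_has_gauge[OF c y])
  interpret star_gauge T a \<rho> by (rule T(1))
  have hom: "homeomorphic_map T (subtopology X c) g"
    using T(2) homeomorphic_maps_map by blast
  have "T closure_of sublevel 1 = topspace T"
    using closure_of_sublevel[of 1] \<rho>_le_1 by auto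
  then have "subtopology X c closure_of cell_interior X c = g ` topspace T"
    using homeomorphic_map_closure_of[OF hom, of "sublevel 1"] T(4) by auto
  also have "\<dots> = topspace (subtopology X c)"
    using hom by (rule homeomorphic_imp_surjective_map)
  also have "\<dots> = c" using c by (auto simp: is_cell_def)
  finally show ?thesis using closure_of_subtopology_subset[of X c "cell_interior X c"] by simp
qed

lemma compactin_cell:
  assumes c: "is_cell X c" shows "compactin X c"
proof -
  obtain y where y: "y \<in> cell_interior X c" using cell_interior_nonempty[OF c] by blast
  obtain T :: "(nat \<Rightarrow> real) topology" and a \<rho> h g
    where T: "star_gauge T a \<rho>" "homeomorphic_maps (subtopology X c) T h g" "g a = y"
      "g ` {q \<in> topspace T. \<rho> q < 1} = cell_interior X c"
    by (rule cell_interior_has_gauge[OF c y])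
  have "compact_space T" using star_gauge.compact_T[OF T(1)] .
  moreover have "T homeomorphic_space subtopology X c"
    using T(2) homeomorphic_maps_sym unfolding homeomorphic_space_def by blast
  ultimately have "compact_space (subtopology X c)"
    using homeomorphic_compact_space by blast
  then show ?thesis using c by (simp add: compactin_subspace is_cell_def)
qed

lemma cell_homeomorphic_preimage:
  assumes c: "c \<subseteq> topspace X" and hom: "homeomorphic_map (subtopology X c) (subtopology Y (f ` c)) f"
    and cell: "is_cell Y (f ` c)"
  shows "is_cell X c"
    and "x \<in> c \<Longrightarrow> x \<in> cell_interior X c \<longleftrightarrow> f x \<in> cell_interior Y (f ` c)"
proof -
  obtain k h where fc: "f ` c \<subseteq> topspace Y" and h: "cell_chart Y k (f ` c) h"
    using cell by (auto simp: is_cell_def)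
  have hf: "cell_chart X k c (h \<circ> f)"
    using homeomorphic_map_compose[OF hom] h by (simp add: cell_chart_def)
  then show "is_cell X c" using c by (auto simp: is_cell_def)
  assume "x \<in> c"
  then show "x \<in> cell_interior X c \<longleftrightarrow> f x \<in> cell_interior Y (f ` c)"
    unfolding cell_interior_chart[OF h fc] cell_interior_chart[OF hf c] by simp
qed

section \<open>Finiteness and open cells of a decomposition\<close>

lemma cell_decompositionD:
  assumes D: "cell_decomposition X D"
  shows "\<And>c. c \<in> D \<Longrightarrow> is_cell X c" "\<Union>D = topspace X"
    "\<And>c c' y. \<lbrakk>c \<in> D; c' \<in> D; y \<in> cell_interior X c; y \<in> cell_interior X c'\<rbrakk> \<Longrightarrow> c = c'"
    "\<And>c. c \<in> D \<Longrightarrow> \<exists>S\<subseteq>D. cell_boundary X c = \<Union>S"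
    "\<And>c. c \<in> D \<Longrightarrow> c \<subseteq> topspace X"
proof -
  show "is_cell X c" if "c \<in> D" for c
    using D that by (simp add: cell_decomposition_def)
  show union: "\<Union>D = topspace X"
    using D by (simp add: cell_decomposition_def)
  show "c = c'" if "c \<in> D" "c' \<in> D" "y \<in> cell_interior X c" "y \<in> cell_interior X c'" for c c' y
  proof (rule ccontr)
    assume "c \<noteq> c'"
    then have "cell_interior X c \<inter> cell_interior X c' = {}"
      using D that(1,2) by (simp add: cell_decomposition_def)
    then show False using that(3,4) by blast
  qed
  show "\<exists>S\<subseteq>D. cell_boundary X c = \<Union>S" if "c \<in> D" for c
    using D that by (simp add: cell_decomposition_def)
  show "c \<subseteq> topspace X" if "c \<in> D" for c
    using union that by blast
qed

lemma finite_cell_decomposition: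
  assumes X: "compact_space X" and D: "cell_decomposition X D"
  shows "finite D"
proof -
  let ?\<U> = "{U. openin X U \<and> finite {c \<in> D. c \<inter> U \<noteq> {}}}"
  have "topspace X \<subseteq> \<Union>?\<U>"
  proof
    fix x assume "x \<in> topspace X"
    then obtain U where "openin X U" "x \<in> U" "finite {c \<in> D. c \<inter> U \<noteq> {}}"
      using D by (auto simp: cell_decomposition_def)
    then show "x \<in> \<Union>?\<U>" by (intro UnionI[of U]) simp_all
  qed
  then obtain F where F: "finite F" "F \<subseteq> ?\<U>" "topspace X \<subseteq> \<Union>F"
    using X unfolding compact_space_alt by (elim allE[of _ ?\<U>]) auto
  have "D \<subseteq> (\<Union>V\<in>F. {c \<in> D. c \<inter> V \<noteq> {}})"
  proof
    fix c assume c: "c \<in> D"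
    then obtain x where x: "x \<in> c"
      using cell_interior_nonempty[OF cell_decompositionD(1)[OF D c]] cell_interior_subset[of X c] by blast
    then have "x \<in> \<Union>F" using F(3) cell_decompositionD(5)[OF D c] by blast
    then show "c \<in> (\<Union>V\<in>F. {c \<in> D. c \<inter> V \<noteq> {}})" using c x by blast
  qed
  moreover have "finite (\<Union>V\<in>F. {c \<in> D. c \<inter> V \<noteq> {}})"
    using F(1,2) by (intro finite_UN_I) auto
  ultimately show ?thesis by (rule finite_subset)
qed

text \<open>Take a cell minimal among those containing \<open>y\<close> inside \<open>c\<close>. If
  \<open>y\<close> were on its boundary, a boundary cell through \<open>y\<close> would equal it by
  minimality, leaving it without interior.\<close>

lemma point_in_cell_interior:
  assumes D: "cell_decomposition X D" "finite D" and c: "c \<in> D" "y \<in> c"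
  obtains e where "e \<in> D" "e \<subseteq> c" "y \<in> cell_interior X e"
proof -
  let ?A = "{e \<in> D. e \<subseteq> c \<and> y \<in> e}"
  have "finite ?A" "?A \<noteq> {}" using D(2) c by auto
  then have "\<exists>e\<in>?A. \<forall>e'\<in>?A. e' \<subseteq> e \<longrightarrow> e = e'" by (rule finite_has_minimal)
  then obtain e where e: "e \<in> ?A" and minimal: "\<forall>e'\<in>?A. e' \<subseteq> e \<longrightarrow> e = e'" by (elim bexE)
  have "y \<in> cell_interior X e"
  proof (rule ccontr)
    assume "y \<notin> cell_interior X e"
    then have yb: "y \<in> cell_boundary X e" using e by (simp add: cell_boundary_eq)
    obtain S where S: "S \<subseteq> D" "cell_boundary X e = \<Union>S"
      using cell_decompositionD(4)[OF D(1), of e] e by blast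
    then obtain e' where e': "e' \<in> S" "y \<in> e'" using yb by blast
    then have sub: "e' \<subseteq> cell_boundary X e" using S by blast
    then have "e' \<subseteq> e" by (auto simp: cell_boundary_eq)
    moreover have "e' \<in> ?A" using e' S(1) e \<open>e' \<subseteq> e\<close> by blast
    ultimately have "e = e'" using minimal by simp
    then have "cell_interior X e = {}"
      using sub cell_interior_subset[of X e] unfolding cell_boundary_eq by blast
    moreover have "is_cell X e" using cell_decompositionD(1)[OF D(1)] e by blast
    ultimately show False using cell_interior_nonempty by blast
  qed
  then show thesis using e by (intro that[of e]) auto
qed

section \<open>Lifting the cells of a decomposition\<close>

context compact_branched_cover
begin

text \<open>The lifted cell is the image of a section \<open>s\<close> of \<open>f\<close> over the
  cell, based at \<open>x\<close>; composing \<open>s\<close> with the chart inverts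
  \<open>f\<close> on it.\<close>

lemma cell_lift_exists:
  assumes c: "is_cell M c" and inj: "locally_injective_over M f (cell_interior M c)"
    and x: "x \<in> topspace M" "f x \<in> cell_interior M c"
  obtains c' where "x \<in> c'" "c' \<subseteq> topspace M" "f ` c' = c"
    "homeomorphic_map (subtopology M c') (subtopology M c) f"
proof -
  obtain T :: "(nat \<Rightarrow> real) topology" and a \<rho> h g
    where T: "star_gauge T a \<rho>" "homeomorphic_maps (subtopology M c) T h g" "g a = f x"
      "g ` {q \<in> topspace T. \<rho> q < 1} = cell_interior M c"
    using cell_interior_has_gauge[OF c x(2)] .
  interpret star_gauge T a \<rho> by (rule T(1))
  have cM: "c \<subseteq> topspace M" using c by (simp add: is_cell_def)
  then have top: "topspace (subtopology M c) = c" by (simp add: inf_absorb2)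
  have hc: "continuous_map (subtopology M c) T h" and gc: "continuous_map T (subtopology M c) g"
    and gh: "\<And>y. y \<in> c \<Longrightarrow> g (h y) = y" and hg: "\<And>q. q \<in> topspace T \<Longrightarrow> h (g q) = q"
    using T(2) unfolding homeomorphic_maps_def top by auto
  have gM: "continuous_map T M g" using gc continuous_map_in_subtopology by blast
  have g_inj: "inj_on g (topspace T)" using hg by (rule inj_on_inverseI)
  have g_mem: "g q \<in> c" if "q \<in> topspace T" for q
    using continuous_map_funspace[OF gc] that top by blast
  have h_mem: "h y \<in> topspace T" if "y \<in> c" for y
    using continuous_map_funspace[OF hc] that top by blast
  have inj': "locally_injective_over M f (g ` sublevel 1)" using inj T(4) by simp
  obtain s where s: "continuous_map T M s" "\<And>q. q \<in> topspace T \<Longrightarrow> f (s q) = g q" "s a = x"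
    using lift_exists[OF compact Hausdorff Hausdorff continuous_f open_f finite_fibre gM g_inj inj' x(1)]
      T(3) by metis
  let ?c' = "s ` topspace T"
  have c'M: "?c' \<subseteq> topspace M" using continuous_map_image_subset_topspace[OF s(1)] by blast
  then have top': "topspace (subtopology M ?c') = ?c'" by (simp add: inf_absorb2)
  have fc': "f ` ?c' = c"
  proof (intro equalityI subsetI)
    fix y assume "y \<in> f ` ?c'"
    then show "y \<in> c" using s(2) g_mem by auto
  next
    fix y assume y: "y \<in> c"
    then have "f (s (h y)) = y" using s(2) gh h_mem by simp
    then show "y \<in> f ` ?c'" using h_mem[OF y] by force
  qed
  have "homeomorphic_maps (subtopology M ?c') (subtopology M c) f (s \<circ> h)"
    unfolding homeomorphic_maps_def top top'
  proof (intro conjI ballI)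
    show "continuous_map (subtopology M ?c') (subtopology M c) f"
      using fc' continuous_f top'
      by (auto simp: continuous_map_in_subtopology intro!: continuous_map_from_subtopology)
    have "continuous_map T (subtopology M ?c') s"
      using s(1) by (auto simp: continuous_map_in_subtopology)
    then show "continuous_map (subtopology M c) (subtopology M ?c') (s \<circ> h)"
      using hc continuous_map_compose by blast
    fix z assume "z \<in> ?c'"
    then show "(s \<circ> h) (f z) = z" using s(2) hg by auto
  next
    fix y assume "y \<in> c"
    then show "f ((s \<circ> h) y) = y" using s(2) gh h_mem by simp
  qed
  then have "homeomorphic_map (subtopology M ?c') (subtopology M c) f"
    by (rule homeomorphic_maps_imp_map)
  moreover have "x \<in> ?c'" using s(3) center by (intro image_eqI[of _ s a]) auto
  ultimately show thesis by (intro that[of ?c'] c'M fc')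
qed

text \<open>The inverses of \<open>f\<close> on the two sheets, restricted to \<open>C\<close>, are
  lifts of the inclusion of \<open>C\<close> that coincide at \<open>f x\<close>, hence everywhere
  on \<open>C\<close>.\<close>

lemma sheets_agree:
  assumes b: "b \<subseteq> topspace M" "homeomorphic_map (subtopology M b) (subtopology M (f ` b)) f"
    and b': "b' \<subseteq> topspace M" "homeomorphic_map (subtopology M b') (subtopology M (f ` b')) f"
    and C: "connectedin M C" "C \<subseteq> f ` b" "C \<subseteq> f ` b'" and inj: "locally_injective_over M f C"
    and x: "x \<in> b" "x \<in> b'" "f x \<in> C"
  shows "C \<subseteq> f ` (b \<inter> b')"
proof
  have inv: "\<exists>s. continuous_map (subtopology M C) M s \<and> (\<forall>y\<in>C. s y \<in> b \<and> f (s y) = y)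
      \<and> (\<forall>z\<in>b. s (f z) = z)"
    if b: "b \<subseteq> topspace M" "homeomorphic_map (subtopology M b) (subtopology M (f ` b)) f"
      and C: "C \<subseteq> f ` b" for b
  proof -
    obtain s where s: "homeomorphic_maps (subtopology M b) (subtopology M (f ` b)) f s"
      using b(2) homeomorphic_map_maps[THEN iffD1] by blast
    have top: "topspace (subtopology M b) = b" "topspace (subtopology M (f ` b)) = f ` b"
      using b(1) f_mem by (auto simp: inf_absorb2)
    have sc: "continuous_map (subtopology M (f ` b)) (subtopology M b) s"
      and sf: "\<forall>z\<in>b. s (f z) = z" and fs: "\<forall>y\<in>f ` b. f (s y) = y"
      using s unfolding homeomorphic_maps_def top by auto
    have "continuous_map (subtopology M (f ` b)) M s"
      using sc continuous_map_in_subtopology by blast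
    then have "continuous_map (subtopology M C) M s"
      using C by (rule continuous_map_from_subtopology_mono)
    moreover have "\<forall>y\<in>C. s y \<in> b \<and> f (s y) = y"
      using C fs sf by auto
    ultimately show ?thesis using sf by blast
  qed
  obtain s where s: "continuous_map (subtopology M C) M s"
    "\<forall>y\<in>C. s y \<in> b \<and> f (s y) = y" "\<forall>z\<in>b. s (f z) = z"
    using inv[OF b C(2)] by blast
  obtain t where t: "continuous_map (subtopology M C) M t"
    "\<forall>y\<in>C. t y \<in> b' \<and> f (t y) = y" "\<forall>z\<in>b'. t (f z) = z"
    using inv[OF b' C(3)] by blast
  have top: "topspace (subtopology M C) = C"
    using connectedin_subset_topspace[OF C(1)] by (simp add: inf_absorb2)
  fix y assume y: "y \<in> C"
  have "s y = t y"
  proof (rule lifts_agree[where Z = "subtopology M C" and f = f, OF _ Hausdorff s(1) t(1) _ _ inj])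
    show "connected_space (subtopology M C)" using C(1) by (simp add: connectedin_def)
    show "f x \<in> topspace (subtopology M C)" "y \<in> topspace (subtopology M C)"
      unfolding top using x(3) y by auto
    show "s (f x) = t (f x)" using s(3) t(3) x(1,2) by simp
    fix z assume "z \<in> topspace (subtopology M C)"
    then have "z \<in> C" unfolding top .
    then show "f (s z) = f (t z)" "f (s z) \<in> C" using s(2) t(2) by simp_all
  qed
  then have "s y \<in> b \<inter> b'" "f (s y) = y" using s(2) t(2) y by simp_all metis
  then show "y \<in> f ` (b \<inter> b')" by force
qed

definition cell_lifts :: "'a set set \<Rightarrow> 'a set set" where
  "cell_lifts D = {c. c \<subseteq> topspace M \<and> f ` c \<in> D \<and>
     homeomorphic_map (subtopology M c) (subtopology M (f ` c)) f}"

text \<open>The sheets agree over the open cell. Their intersection is compact, so its image is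
  closed and contains the closure of the open cell, which contains the whole cell.\<close>

lemma cell_lift_unique:
  assumes D: "cell_decomposition M D"
    and inj: "\<And>c. c \<in> D \<Longrightarrow> locally_injective_over M f (cell_interior M c)"
    and c: "c \<in> cell_lifts D" "c' \<in> cell_lifts D" "f ` c = f ` c'"
    and x: "x \<in> c" "x \<in> c'" "f x \<in> cell_interior M (f ` c)"
  shows "c = c'"
proof -
  have c1: "c \<subseteq> topspace M" "f ` c \<in> D" "homeomorphic_map (subtopology M c) (subtopology M (f ` c)) f"
    and c2: "c' \<subseteq> topspace M" "f ` c' \<in> D" "homeomorphic_map (subtopology M c') (subtopology M (f ` c')) f"
    using c(1,2) by (auto simp: cell_lifts_def)
  have cell: "is_cell M (f ` c)" using cell_decompositionD(1)[OF D c1(2)] .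
  let ?I = "cell_interior M (f ` c)"
  have "?I \<subseteq> f ` (c \<inter> c')"
  proof (rule sheets_agree[OF c1(1,3) c2(1,3) _ _ _ inj[OF c1(2)] x])
    show "connectedin M ?I" by (rule connectedin_cell_interior[OF cell])
  qed (use cell_interior_subset[of M "f ` c"] c(3) in auto)
  moreover have "closedin M (f ` (c \<inter> c'))"
  proof -
    have "is_cell M c" "is_cell M c'"
      using cell_homeomorphic_preimage(1)[OF c1(1,3) cell]
        cell_homeomorphic_preimage(1)[OF c2(1,3)] cell c(3) by simp_all
    then have "closedin M c" "closedin M c'"
      using compactin_cell compactin_imp_closedin[OF Hausdorff] by blast+
    then have "closedin M (c \<inter> c')" by (rule closedin_Int)
    then show ?thesis using closed_f by (simp add: closed_map_def)
  qed
  ultimately have "M closure_of ?I \<subseteq> f ` (c \<inter> c')" by (rule closure_of_minimal)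
  then have sub: "f ` c \<subseteq> f ` (c \<inter> c')"
    using cell_subset_closure_of_interior[OF cell] by blast
  have "inj_on f c" "inj_on f c'"
    using homeomorphic_imp_injective_map[OF c1(3)] homeomorphic_imp_injective_map[OF c2(3)] c1(1) c2(1)
    by (simp_all add: inf_absorb2)
  then have "c \<subseteq> c \<inter> c'" "c' \<subseteq> c \<inter> c'"
    using sub c(3) inj_on_image_subset_iff[of f c c "c \<inter> c'"]
      inj_on_image_subset_iff[of f c' c' "c \<inter> c'"] by auto
  then show ?thesis by blast
qed

lemma cell_decomposition_cell_lifts:
  assumes D: "cell_decomposition M D"
    and inj: "\<And>c. c \<in> D \<Longrightarrow> locally_injective_over M f (cell_interior M c)"
  shows "cell_decomposition M (cell_lifts D)"
proof -
  note D_cell = cell_decompositionD(1)[OF D]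
  have finD: "finite D" by (rule finite_cell_decomposition[OF compact D])
  have L: "c \<subseteq> topspace M" "f ` c \<in> D" "homeomorphic_map (subtopology M c) (subtopology M (f ` c)) f"
    if "c \<in> cell_lifts D" for c
    using that by (auto simp: cell_lifts_def)
  have cell: "is_cell M c" if "c \<in> cell_lifts D" for c
    using cell_homeomorphic_preimage(1)[OF L(1,3)[OF that] D_cell[OF L(2)[OF that]]] .
  have interior: "x \<in> cell_interior M c \<longleftrightarrow> f x \<in> cell_interior M (f ` c)"
    if "c \<in> cell_lifts D" "x \<in> c" for c x
    using cell_homeomorphic_preimage(2)[OF L(1,3)[OF that(1)] D_cell[OF L(2)[OF that(1)]] that(2)] .
  have cover: "\<Union>(cell_lifts D) = topspace M"
  proof (intro equalityI subsetI)
    fix x assume x: "x \<in> topspace M"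
    then obtain c0 where "c0 \<in> D" "f x \<in> c0"
      using f_mem cell_decompositionD(2)[OF D] by blast
    then obtain c where c: "c \<in> D" "f x \<in> cell_interior M c"
      using point_in_cell_interior[OF D finD] by blast
    then obtain c' where "x \<in> c'" "c' \<subseteq> topspace M" "f ` c' = c"
      "homeomorphic_map (subtopology M c') (subtopology M c) f"
      using cell_lift_exists[OF D_cell inj x] by blast
    then show "x \<in> \<Union>(cell_lifts D)" using c(1) by (auto simp: cell_lifts_def)
  qed (use L in blast)
  have disjoint: "c = c'" if c: "c \<in> cell_lifts D" "c' \<in> cell_lifts D"
    and x: "x \<in> cell_interior M c" "x \<in> cell_interior M c'" for c c' x
  proof -
    have xc: "x \<in> c" "x \<in> c'"
      using x cell_interior_subset[of M c] cell_interior_subset[of M c'] by blast+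
    then have fx: "f x \<in> cell_interior M (f ` c)" "f x \<in> cell_interior M (f ` c')"
      using interior c x by blast+
    then have "f ` c = f ` c'" using cell_decompositionD(3)[OF D L(2)[OF c(1)] L(2)[OF c(2)]] by blast
    then show ?thesis using cell_lift_unique[OF D inj c _ xc fx(1)] by blast
  qed
  have boundary: "\<exists>S\<subseteq>cell_lifts D. cell_boundary M c = \<Union>S" if c: "c \<in> cell_lifts D" for c
  proof -
    obtain S where S: "S \<subseteq> D" "cell_boundary M (f ` c) = \<Union>S"
      using cell_decompositionD(4)[OF D L(2)[OF c]] by meson
    \<comment> \<open>The boundary cells of a lifted cell are its pieces over the boundary cells
      below; restricting the homeomorphism shows that they are lifts themselves.\<close>
    let ?S = "(\<lambda>e. {x \<in> c. f x \<in> e}) ` S"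
    have "?S \<subseteq> cell_lifts D"
    proof
      fix e' assume "e' \<in> ?S"
      then obtain e where e: "e \<in> S" "e' = {x \<in> c. f x \<in> e}" by blast
      have ec: "e \<subseteq> f ` c" using e(1) S(2) by (auto simp: cell_boundary_eq)
      then have fe: "f ` e' = e" using e(2) by blast
      have "homeomorphic_map (subtopology (subtopology M c) e') (subtopology (subtopology M (f ` c)) e) f"
      proof (rule homeomorphic_map_subtopologies[OF L(3)[OF c]])
        show "f ` (topspace (subtopology M c) \<inter> e') = topspace (subtopology M (f ` c)) \<inter> e"
          using e(2) fe ec L(1)[OF c] f_mem by auto
      qed
      moreover have "c \<inter> e' = e'" "f ` c \<inter> e = e" using e(2) ec by auto
      ultimately have "homeomorphic_map (subtopology M e') (subtopology M e) f"
        by (simp add: subtopology_subtopology)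
      then show "e' \<in> cell_lifts D"
        unfolding cell_lifts_def fe[symmetric] using S(1) e fe L(1)[OF c] by auto
    qed
    moreover have "cell_boundary M c = \<Union>?S"
    proof -
      have "cell_boundary M c = {x \<in> c. f x \<in> cell_boundary M (f ` c)}"
        using interior[OF c] by (auto simp: cell_boundary_eq)
      also have "\<dots> = \<Union>?S" unfolding S(2) by auto
      finally show ?thesis .
    qed
    ultimately show ?thesis by blast
  qed
  \<comment> \<open>Local finiteness comes from finiteness: a lift is determined by its image cell
    and by its point over a fixed interior point of that cell, and there are finitely many of
    both.\<close>
  have "\<exists>y. y \<in> cell_interior M c" if "c \<in> D" for c
    using cell_interior_nonempty[OF D_cell[OF that]] by blast
  then obtain y where y: "\<And>c. c \<in> D \<Longrightarrow> y c \<in> cell_interior M c" by metis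
  have cover_sheets: "cell_lifts D \<subseteq> (\<Union>c\<in>D. \<Union>x\<in>fibre (y c). {c' \<in> cell_lifts D. f ` c' = c \<and> x \<in> c'})"
  proof
    fix c' assume c': "c' \<in> cell_lifts D"
    have "y (f ` c') \<in> f ` c'" using y[OF L(2)[OF c']] cell_interior_subset[of M "f ` c'"] by blast
    then obtain x where "x \<in> c'" "f x = y (f ` c')" by force
    then show "c' \<in> (\<Union>c\<in>D. \<Union>x\<in>fibre (y c). {c' \<in> cell_lifts D. f ` c' = c \<and> x \<in> c'})"
      using c' L(1,2)[OF c'] by blast
  qed
  have sheet: "finite {c' \<in> cell_lifts D. f ` c' = c \<and> x \<in> c'}" (is "finite ?S")
    if "c \<in> D" "x \<in> fibre (y c)" for c x
  proof -
    have unique: "c1 = c2" if c1: "c1 \<in> cell_lifts D" "f ` c1 = c" "x \<in> c1"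
      and c2: "c2 \<in> cell_lifts D" "f ` c2 = c" "x \<in> c2" for c1 c2
    proof (rule cell_lift_unique[OF D inj c1(1) c2(1) _ c1(3) c2(3)])
      show "f ` c1 = f ` c2" using c1(2) c2(2) by simp
      show "f x \<in> cell_interior M (f ` c1)"
        using y[OF \<open>c \<in> D\<close>] \<open>x \<in> fibre (y c)\<close> c1(2) by simp
    qed
    show ?thesis
    proof (cases "?S = {}")
      case False
      then obtain d where d: "d \<in> ?S" by blast
      have "?S \<subseteq> {d}"
      proof
        fix e assume "e \<in> ?S"
        then show "e \<in> {d}" using unique[of e d] d by simp
      qed
      then show ?thesis by (rule finite_subset) simp
    next
      case True
      then show ?thesis by (simp only: finite.emptyI)
    qed
  qed
  have "finite (\<Union>c\<in>D. \<Union>x\<in>fibre (y c). {c' \<in> cell_lifts D. f ` c' = c \<and> x \<in> c'})"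
    by (intro finite_UN_I finD finite_fibre sheet)
  then have fin: "finite (cell_lifts D)"
    by (rule finite_subset[OF cover_sheets])
  show ?thesis
    unfolding cell_decomposition_def
  proof (intro conjI ballI impI)
    fix c c' assume "c \<in> cell_lifts D" "c' \<in> cell_lifts D" "c \<noteq> c'"
    then show "cell_interior M c \<inter> cell_interior M c' = {}" using disjoint by blast
  next
    fix x assume "x \<in> topspace M"
    then show "\<exists>U. openin M U \<and> x \<in> U \<and> finite {c \<in> cell_lifts D. c \<inter> U \<noteq> {}}"
      using fin by (intro exI[of _ "topspace M"]) auto
  qed (use cell cover boundary in auto)
qed

lemma cellular_cell_lifts:
  assumes D: "cell_decomposition M D"
    and inj: "\<And>c. c \<in> D \<Longrightarrow> locally_injective_over M f (cell_interior M c)"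
  shows "cellular M M (cell_lifts D) D f"
  unfolding cellular_def
  using D cell_decomposition_cell_lifts[OF D inj] continuous_f by (auto simp: cell_lifts_def)

end

section \<open>Iterated pull-backs\<close>

locale cpcf_map = compact_branched_cover +
  fixes P P\<^sub>0 D\<^sub>0 B :: "'a set set"
  assumes refinement: "cell_refinement (subtopology M (postcritical_set M f)) P\<^sub>0 P"
    and cellular_P\<^sub>0: "cellular (subtopology M (postcritical_set M f))
          (subtopology M (postcritical_set M f)) P\<^sub>0 P f"
    and D\<^sub>0: "cell_decomposition M D\<^sub>0" and P\<^sub>0_sub: "P\<^sub>0 \<subseteq> D\<^sub>0"
    and cellular_B: "cellular (subtopology M (branch_set M f))
          (subtopology M (postcritical_set M f)) B P f"
    and index_constant: "\<And>c x y. \<lbrakk>c \<in> B; x \<in> cell_interior (subtopology M (branch_set M f)) c;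
          y \<in> cell_interior (subtopology M (branch_set M f)) c\<rbrakk>
          \<Longrightarrow> local_index M f x = local_index M f y"
begin

abbreviation "P\<^sub>f \<equiv> postcritical_set M f"

lemma P\<^sub>f_subset: "P\<^sub>f \<subseteq> topspace M"
proof -
  have "(f ^^ m) x \<in> topspace M" if "x \<in> topspace M" for m x
    using that f_mem by (induction m) auto
  then show ?thesis unfolding postcritical_set_def branch_set_def by blast
qed

lemma branch_values_subset: "f ` B\<^sub>f \<subseteq> P\<^sub>f"
  unfolding postcritical_set_def using UN_upper[of 1 "{1..}" "\<lambda>m. (f ^^ m) ` B\<^sub>f"] by simp

lemma topspace_P\<^sub>f: "topspace (subtopology M P\<^sub>f) = P\<^sub>f"
  using P\<^sub>f_subset by (simp add: inf_absorb2)

lemma topspace_B\<^sub>f: "topspace (subtopology M B\<^sub>f) = B\<^sub>f"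
  using closedin_subset[OF closedin_branch_set] by (simp add: inf_absorb2)

lemma P_decomposition: "cell_decomposition (subtopology M P\<^sub>f) P"
  and P\<^sub>0_decomposition: "cell_decomposition (subtopology M P\<^sub>f) P\<^sub>0"
  and B_decomposition: "cell_decomposition (subtopology M B\<^sub>f) B"
  using refinement cellular_B by (auto simp: cell_refinement_def cellular_def)

lemma P_subset: "p \<in> P \<Longrightarrow> p \<subseteq> P\<^sub>f"
  and P\<^sub>0_subset: "e \<in> P\<^sub>0 \<Longrightarrow> e \<subseteq> P\<^sub>f"
  and B_subset: "b \<in> B \<Longrightarrow> b \<subseteq> B\<^sub>f"
  using cell_decompositionD(5)[OF P_decomposition] cell_decompositionD(5)[OF P\<^sub>0_decomposition]
    cell_decompositionD(5)[OF B_decomposition] topspace_P\<^sub>f topspace_B\<^sub>f by auto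

lemma is_cell_P: "p \<in> P \<Longrightarrow> is_cell M p"
  using cell_decompositionD(1)[OF P_decomposition] P_subset is_cell_subtopology by blast

lemma P_eq_Union: "p \<in> P \<Longrightarrow> p = \<Union>{e \<in> P\<^sub>0. e \<subseteq> p}"
  using refinement by (simp add: cell_refinement_def)

lemma finite_P\<^sub>0: "finite P\<^sub>0"
  using finite_cell_decomposition[OF compact D\<^sub>0] P\<^sub>0_sub finite_subset by blast

lemma finite_P: "finite P"
proof -
  have "P \<subseteq> Union ` Pow P\<^sub>0"
  proof
    fix p assume "p \<in> P"
    then show "p \<in> Union ` Pow P\<^sub>0"
      using P_eq_Union by (intro image_eqI[of _ _ "{e \<in> P\<^sub>0. e \<subseteq> p}"]) auto
  qed
  then show ?thesis by (rule finite_subset) (simp add: finite_P\<^sub>0)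
qed

lemma finite_B: "finite B"
proof (rule finite_cell_decomposition[OF _ B_decomposition])
  show "compact_space (subtopology M B\<^sub>f)"
    using closedin_compact_space[OF compact closedin_branch_set] by (rule compact_space_subtopology)
qed

lemma P\<^sub>0_point_interior:
  assumes "e \<in> P\<^sub>0" "y \<in> e"
  obtains e' where "e' \<in> P\<^sub>0" "e' \<subseteq> e" "y \<in> cell_interior M e'"
  using point_in_cell_interior[OF P\<^sub>0_decomposition finite_P\<^sub>0 assms]
    cell_interior_subtopology[OF P\<^sub>0_subset] by metis

lemma P_interior_unique:
  "\<lbrakk>p \<in> P; p' \<in> P; y \<in> cell_interior M p; y \<in> cell_interior M p'\<rbrakk> \<Longrightarrow> p = p'"
  using cell_decompositionD(3)[OF P_decomposition, of p p' y] cell_interior_subtopology[OF P_subset]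
  by simp

text \<open>The point lies in the interior of some cell of \<open>P\<^sub>0\<close> inside
  \<open>p\<close>. That cell belongs to \<open>D\<^sub>0\<close>, so disjointness of open cells
  identifies it with \<open>c\<close>.\<close>

lemma D\<^sub>0_cell_in_P_cell:
  assumes p: "p \<in> P" and c: "c \<in> D\<^sub>0" and y: "y \<in> cell_interior M c" "y \<in> p"
  shows "c \<in> P\<^sub>0" "c \<subseteq> p"
proof -
  obtain e where e: "e \<in> P\<^sub>0" "e \<subseteq> p" "y \<in> e" using P_eq_Union[OF p] y(2) by blast
  obtain e' where e': "e' \<in> P\<^sub>0" "e' \<subseteq> e" "y \<in> cell_interior M e'"
    using P\<^sub>0_point_interior[OF e(1,3)] .
  have "e' = c"
    using cell_decompositionD(3)[OF D\<^sub>0 _ c e'(3) y(1)] e'(1) P\<^sub>0_sub by blast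
  then show "c \<in> P\<^sub>0" "c \<subseteq> p" using e e' by auto
qed

lemma P_point_interior:
  assumes "y \<in> P\<^sub>f"
  obtains p where "p \<in> P" "y \<in> cell_interior M p"
proof -
  obtain p0 where p0: "p0 \<in> P" "y \<in> p0"
    using assms cell_decompositionD(2)[OF P_decomposition] topspace_P\<^sub>f by auto
  obtain p where "p \<in> P" "y \<in> cell_interior (subtopology M P\<^sub>f) p"
    using point_in_cell_interior[OF P_decomposition finite_P p0] by blast
  then show thesis using that cell_interior_subtopology[OF P_subset] by metis
qed

definition adapted :: "'a set set \<Rightarrow> bool" where
  "adapted D \<longleftrightarrow> (\<forall>c\<in>D. cell_interior M c \<inter> P\<^sub>f = {} \<or> (\<exists>p\<in>P. cell_interior M c \<subseteq> cell_interior M p))"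

text \<open>A cell of \<open>P\<close> through any interior point of \<open>c\<close> contains all
  of \<open>c\<close>. If one interior point were on the boundary of the cell \<open>p'\<close>
  while another is interior to it, a boundary cell would swallow \<open>c\<close>, the second point
  included. So one open cell serves all points.\<close>

lemma P\<^sub>0_interior_subset:
  assumes c: "c \<in> P\<^sub>0"
  obtains p where "p \<in> P" "cell_interior M c \<subseteq> cell_interior M p"
proof -
  have cD: "c \<in> D\<^sub>0" using c P\<^sub>0_sub by blast
  have "is_cell M c" by (rule cell_decompositionD(1)[OF D\<^sub>0 cD])
  then obtain y where y: "y \<in> cell_interior M c" using cell_interior_nonempty by blast
  have cP: "cell_interior M c \<subseteq> P\<^sub>f" using P\<^sub>0_subset[OF c] cell_interior_subset[of M c] by blast
  obtain p where p: "p \<in> P" "y \<in> cell_interior M p" using P_point_interior[of y] y cP by blast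
  have "cell_interior M c \<subseteq> cell_interior M p"
  proof
    fix y' assume y': "y' \<in> cell_interior M c"
    obtain p' where p': "p' \<in> P" "y' \<in> cell_interior M p'" using P_point_interior[of y'] y' cP by blast
    have "y' \<in> p'" using p'(2) cell_interior_subset[of M p'] by blast
    then have cp': "c \<subseteq> p'" using D\<^sub>0_cell_in_P_cell(2)[OF p'(1) cD y'] by blast
    have "y \<in> cell_interior M p'"
    proof (rule ccontr)
      assume "y \<notin> cell_interior M p'"
      then have "y \<in> cell_boundary M p'"
        using cp' y cell_interior_subset[of M c] unfolding cell_boundary_eq by blast
      moreover obtain S where S: "S \<subseteq> P" "cell_boundary M p' = \<Union>S"
        using cell_decompositionD(4)[OF P_decomposition p'(1)]
          cell_boundary_subtopology[OF P_subset[OF p'(1)]] by auto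
      ultimately obtain q where q: "q \<in> S" "y \<in> q" by blast
      then have "c \<subseteq> q" using D\<^sub>0_cell_in_P_cell(2)[OF _ cD y] S(1) by blast
      then have "y' \<in> cell_boundary M p'" using S q(1) y' cell_interior_subset[of M c] by blast
      then show False using p'(2) by (simp add: cell_boundary_eq)
    qed
    then have "p' = p" using P_interior_unique p p'(1) by blast
    then show "y' \<in> cell_interior M p" using p'(2) by simp
  qed
  then show thesis using that p(1) by blast
qed

lemma adapted_D\<^sub>0: "adapted D\<^sub>0"
  unfolding adapted_def
proof (intro ballI)
  fix c assume c: "c \<in> D\<^sub>0"
  show "cell_interior M c \<inter> P\<^sub>f = {} \<or> (\<exists>p\<in>P. cell_interior M c \<subseteq> cell_interior M p)"
  proof (cases "cell_interior M c \<inter> P\<^sub>f = {}")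
    case False
    then obtain y where y: "y \<in> cell_interior M c" "y \<in> P\<^sub>f" by blast
    obtain p where p: "p \<in> P" "y \<in> cell_interior M p" using P_point_interior[OF y(2)] .
    have "y \<in> p" using p(2) cell_interior_subset[of M p] by blast
    then have "c \<in> P\<^sub>0" by (rule D\<^sub>0_cell_in_P_cell(1)[OF p(1) c y(1)])
    then obtain p' where "p' \<in> P" "cell_interior M c \<subseteq> cell_interior M p'"
      by (rule P\<^sub>0_interior_subset)
    then show ?thesis by (intro disjI2 bexI[of _ p'])
  qed simp
qed

section \<open>Local injectivity over the cells of P\<close>

lemma B_image:
  assumes b: "b \<in> B"
  shows "f ` b \<in> P" "homeomorphic_map (subtopology M b) (subtopology M (f ` b)) f"
proof -
  show fb: "f ` b \<in> P" using cellular_B b by (simp add: cellular_def)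
  have "homeomorphic_map (subtopology (subtopology M B\<^sub>f) b) (subtopology (subtopology M P\<^sub>f) (f ` b)) f"
    using cellular_B b by (simp add: cellular_def)
  then show "homeomorphic_map (subtopology M b) (subtopology M (f ` b)) f"
    using B_subset[OF b] P_subset[OF fb] by (simp add: subtopology_subtopology inf_absorb2)
qed

lemma P\<^sub>0_image:
  assumes e: "e \<in> P\<^sub>0"
  shows "f ` e \<in> P" "homeomorphic_map (subtopology M e) (subtopology M (f ` e)) f"
proof -
  show fe: "f ` e \<in> P" using cellular_P\<^sub>0 e by (simp add: cellular_def)
  have "homeomorphic_map (subtopology (subtopology M P\<^sub>f) e) (subtopology (subtopology M P\<^sub>f) (f ` e)) f"
    using cellular_P\<^sub>0 e by (simp add: cellular_def)
  then show "homeomorphic_map (subtopology M e) (subtopology M (f ` e)) f"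
    using P\<^sub>0_subset[OF e] P_subset[OF fe] by (simp add: subtopology_subtopology inf_absorb2)
qed

lemma local_index_bounded:
  obtains k where "\<And>x. x \<in> topspace M \<Longrightarrow> local_index M f x \<le> enat k"
proof -
  let ?\<C> = "cell_interior M ` {c \<in> D\<^sub>0. cell_interior M c \<inter> f ` B\<^sub>f = {}}"
  have finD: "finite D\<^sub>0" by (rule finite_cell_decomposition[OF compact D\<^sub>0])
  have cover: "\<Union>?\<C> = topspace M - f ` B\<^sub>f"
  proof (intro equalityI subsetI)
    fix y assume "y \<in> \<Union>?\<C>"
    then show "y \<in> topspace M - f ` B\<^sub>f"
      using cell_decompositionD(5)[OF D\<^sub>0] cell_interior_subset[of M] by blast
  next
    fix y assume y: "y \<in> topspace M - f ` B\<^sub>f"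
    then obtain c0 where "c0 \<in> D\<^sub>0" "y \<in> c0" using cell_decompositionD(2)[OF D\<^sub>0] by blast
    then obtain c where c: "c \<in> D\<^sub>0" "y \<in> cell_interior M c"
      using point_in_cell_interior[OF D\<^sub>0 finD] by blast
    \<comment> \<open>No open cell of \<open>D\<^sub>0\<close> straddles the branch values: meeting
      the image of a branch cell, which is a cell of \<open>P\<close>, it lies in that
      image.\<close>
    have "cell_interior M c \<inter> f ` B\<^sub>f = {}"
    proof (rule ccontr)
      assume "cell_interior M c \<inter> f ` B\<^sub>f \<noteq> {}"
      then obtain x where x: "x \<in> B\<^sub>f" "f x \<in> cell_interior M c" by blast
      then obtain b where b: "b \<in> B" "x \<in> b"
        using cell_decompositionD(2)[OF B_decomposition] topspace_B\<^sub>f by auto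
      have "c \<subseteq> f ` b"
        using D\<^sub>0_cell_in_P_cell(2)[OF B_image(1)[OF b(1)] c(1) x(2)] b(2) by blast
      then have "y \<in> f ` B\<^sub>f" using c(2) B_subset[OF b(1)] cell_interior_subset[of M c] by blast
      then show False using y by blast
    qed
    then show "y \<in> \<Union>?\<C>" using c by blast
  qed
  have conn: "connectedin M C" if "C \<in> ?\<C>" for C
    using that connectedin_cell_interior cell_decompositionD(1)[OF D\<^sub>0] by blast
  obtain k where "\<And>y. card (fibre y) \<le> k"
    using card_fibre_bounded[OF _ conn cover] finD by auto
  then show thesis using that local_index_finite by blast
qed

lemma locally_injective_over_P_cell:
  assumes p: "p \<in> P"
  shows "locally_injective_over M f (cell_interior M p)"
  unfolding locally_injective_over_def
proof (intro ballI impI)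
  fix x assume x: "x \<in> topspace M" "f x \<in> cell_interior M p"
  show "\<exists>U. openin M U \<and> x \<in> U \<and> inj_on f (U \<inter> f -` cell_interior M p)"
  proof (cases "x \<in> B\<^sub>f")
    case False
    then obtain U where "openin M U" "x \<in> U" "inj_on f U" using x(1) branch_point_iff by blast
    then show ?thesis by (meson inj_on_subset Int_lower1)
  next
    case True
    then obtain b0 where b0: "b0 \<in> B" "x \<in> b0"
      using cell_decompositionD(2)[OF B_decomposition] topspace_B\<^sub>f by auto
    obtain b where b: "b \<in> B" "x \<in> cell_interior (subtopology M B\<^sub>f) b"
      using point_in_cell_interior[OF B_decomposition finite_B b0] by blast
    have int_b: "cell_interior (subtopology M B\<^sub>f) b = cell_interior M b"
      by (rule cell_interior_subtopology[OF B_subset[OF b(1)]])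
    have xb: "x \<in> b" using b(2) int_b cell_interior_subset[of M b] by blast
    have bM: "b \<subseteq> topspace M" using B_subset[OF b(1)] branch_point_iff by blast
    have int_iff: "z \<in> cell_interior M b \<longleftrightarrow> f z \<in> cell_interior M (f ` b)" if "z \<in> b" for z
      using cell_homeomorphic_preimage(2)[OF bM B_image(2)[OF b(1)] is_cell_P[OF B_image(1)[OF b(1)]] that] .
    \<comment> \<open>\<open>x\<close> is interior to \<open>b\<close>, so its value is interior to
      the cell of \<open>P\<close> that is the image of \<open>b\<close>; disjointness of open cells
      forces this to be \<open>p\<close>.\<close>
    have fb: "f ` b = p"
      using P_interior_unique[OF B_image(1)[OF b(1)] p _ x(2)] int_iff[OF xb] b(2) int_b by simp
    obtain k where k: "local_index M f x \<le> enat k" using local_index_bounded x(1) by metis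
    then obtain m where m: "local_index M f x = enat m" by (cases "local_index M f x") auto
    show ?thesis
    proof (rule locally_injective_over_constant_index[OF bM B_image(2)[OF b(1)] _ _ xb x(2)])
      show "cell_interior M p \<subseteq> f ` b" using fb cell_interior_subset[of M p] by simp
      fix z assume z: "z \<in> b" "f z \<in> cell_interior M p"
      then have "z \<in> cell_interior M b" using int_iff fb by simp
      then show "local_index M f z = enat m"
        using index_constant[OF b(1), of z x] b(2) int_b m by simp
    qed
  qed
qed

lemma locally_injective_over_adapted:
  assumes D: "adapted D" and c: "c \<in> D"
  shows "locally_injective_over M f (cell_interior M c)"
proof -
  consider "cell_interior M c \<inter> P\<^sub>f = {}" | p where "p \<in> P" "cell_interior M c \<subseteq> cell_interior M p"
    using D c unfolding adapted_def by blast
  then show ?thesis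
  proof cases
    case 1
    show ?thesis
      unfolding locally_injective_over_def
    proof (intro ballI impI)
      fix x assume x: "x \<in> topspace M" "f x \<in> cell_interior M c"
      then have "x \<notin> B\<^sub>f" using 1 branch_values_subset by blast
      then obtain U where "openin M U" "x \<in> U" "inj_on f U" using x(1) branch_point_iff by blast
      then show "\<exists>U. openin M U \<and> x \<in> U \<and> inj_on f (U \<inter> f -` cell_interior M c)"
        by (meson inj_on_subset Int_lower1)
    qed
  next
    case 2
    then show ?thesis using locally_injective_over_P_cell locally_injective_over_subset by blast
  qed
qed

text \<open>If the open lifted cell meets \<open>P\<^sub>f\<close> at \<open>x\<close>, it is
  compared with the cell \<open>e\<close> of \<open>P\<^sub>0\<close> having \<open>x\<close> in its
  interior. Both are sheets over the interior below, so they agree there, and \<open>e\<close> is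
  already known to have its interior in an open cell of \<open>P\<close>.\<close>

lemma adapted_cell_lifts:
  assumes D: "cell_decomposition M D" "adapted D"
  shows "adapted (cell_lifts D)"
  unfolding adapted_def
proof (intro ballI)
  fix c assume c: "c \<in> cell_lifts D"
  then have cM: "c \<subseteq> topspace M" and fc: "f ` c \<in> D"
    and hom: "homeomorphic_map (subtopology M c) (subtopology M (f ` c)) f"
    by (auto simp: cell_lifts_def)
  let ?I = "cell_interior M (f ` c)"
  have cell: "is_cell M (f ` c)" by (rule cell_decompositionD(1)[OF D(1) fc])
  have int_iff: "z \<in> cell_interior M c \<longleftrightarrow> f z \<in> ?I" if "z \<in> c" for z
    by (rule cell_homeomorphic_preimage(2)[OF cM hom cell that])
  show "cell_interior M c \<inter> P\<^sub>f = {} \<or> (\<exists>p\<in>P. cell_interior M c \<subseteq> cell_interior M p)"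
  proof (cases "cell_interior M c \<inter> P\<^sub>f = {}")
    case False
    then obtain x where x: "x \<in> cell_interior M c" "x \<in> P\<^sub>f" by blast
    have xc: "x \<in> c" using x(1) cell_interior_subset[of M c] by blast
    obtain e0 where "e0 \<in> P\<^sub>0" "x \<in> e0"
      using x(2) cell_decompositionD(2)[OF P\<^sub>0_decomposition] topspace_P\<^sub>f by auto
    then obtain e where e: "e \<in> P\<^sub>0" "x \<in> cell_interior M e" using P\<^sub>0_point_interior by metis
    have xe: "x \<in> e" using e(2) cell_interior_subset[of M e] by blast
    have eM: "e \<subseteq> topspace M" using P\<^sub>0_subset[OF e(1)] P\<^sub>f_subset by blast
    have e_iff: "z \<in> cell_interior M e \<longleftrightarrow> f z \<in> cell_interior M (f ` e)" if "z \<in> e" for z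
      by (rule cell_homeomorphic_preimage(2)[OF eM P\<^sub>0_image(2)[OF e(1)]
            is_cell_P[OF P\<^sub>0_image(1)[OF e(1)]] that])
    have fx: "f x \<in> ?I" "f x \<in> cell_interior M (f ` e)"
      using int_iff[OF xc] x(1) e_iff[OF xe] e(2) by auto
    \<comment> \<open>Since \<open>f\<close> carries \<open>e\<close> onto a cell of
      \<open>P\<close>, the open cell below meets \<open>P\<^sub>f\<close>, and adaptedness of
      \<open>D\<close> puts it into one open cell of \<open>P\<close>.\<close>
    have "f x \<in> P\<^sub>f" using xe P\<^sub>0_image(1)[OF e(1)] P_subset by blast
    then obtain q where q: "q \<in> P" "?I \<subseteq> cell_interior M q"
      using D(2) fc fx(1) unfolding adapted_def by blast
    have "q = f ` e" using P_interior_unique[OF q(1) P\<^sub>0_image(1)[OF e(1)]] q(2) fx by blast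
    then have I_sub: "?I \<subseteq> cell_interior M (f ` e)" using q(2) by simp
    have "?I \<subseteq> f ` (c \<inter> e)"
    proof (rule sheets_agree[OF cM hom eM P\<^sub>0_image(2)[OF e(1)] _ _ _ _ xc xe fx(1)])
      show "connectedin M ?I" by (rule connectedin_cell_interior[OF cell])
      show "locally_injective_over M f ?I" by (rule locally_injective_over_adapted[OF D(2) fc])
    qed (use I_sub cell_interior_subset[of M "f ` c"] cell_interior_subset[of M "f ` e"] in blast)+
    then have sub: "cell_interior M c \<subseteq> cell_interior M e"
    proof (intro subsetI)
      fix z assume I: "?I \<subseteq> f ` (c \<inter> e)" and z: "z \<in> cell_interior M c"
      then have zc: "z \<in> c" using cell_interior_subset[of M c] by blast
      then have fz: "f z \<in> ?I" using int_iff z by blast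
      then obtain z' where z': "z' \<in> c" "z' \<in> e" "f z = f z'" using I by blast
      have "inj_on f c"
        using homeomorphic_imp_injective_map[OF hom] cM by (simp add: inf_absorb2)
      then have "z = z'" using zc z'(1,3) by (auto dest: inj_onD)
      then have "z \<in> e" using z'(2) by simp
      then show "z \<in> cell_interior M e" using e_iff fz I_sub by blast
    qed
    obtain p where "p \<in> P" "cell_interior M e \<subseteq> cell_interior M p"
      using P\<^sub>0_interior_subset[OF e(1)] .
    then show ?thesis using sub by blast
  qed simp
qed

theorem iterated_cell_lifts:
  "\<exists>D :: nat \<Rightarrow> 'a set set.
     (\<forall>m. cell_decomposition M (D m)) \<and> (\<forall>m. cellular M M (D (Suc m)) (D m) f)"
proof -
  define D where "D m = (cell_lifts ^^ m) D\<^sub>0" for m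
  have D: "cell_decomposition M (D m) \<and> adapted (D m)" for m
  proof (induction m)
    case 0
    show ?case using D\<^sub>0 adapted_D\<^sub>0 by (simp add: D_def)
  next
    case (Suc m)
    have "D (Suc m) = cell_lifts (D m)" by (simp add: D_def)
    moreover have "cell_decomposition M (cell_lifts (D m))"
      using Suc locally_injective_over_adapted by (intro cell_decomposition_cell_lifts) auto
    ultimately show ?case
      using Suc adapted_cell_lifts by simp
  qed
  moreover have "cellular M M (D (Suc m)) (D m) f" for m
  proof -
    have "D (Suc m) = cell_lifts (D m)" by (simp add: D_def)
    moreover have "cellular M M (cell_lifts (D m)) (D m) f"
      using D[of m] locally_injective_over_adapted by (intro cellular_cell_lifts) auto
    ultimately show ?thesis by simp
  qed
  ultimately show ?thesis by blast
qed

end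

theorem theorem3:
  fixes n :: nat and M :: "'a topology" and \<omega> :: "'a \<Rightarrow> 'a chain set" and f :: "'a \<Rightarrow> 'a"
  assumes "n \<ge> 3"
    and "closed_manifold n M" and "connected_space M" and "orientation n M \<omega>"
    and "Thurston_type_map n M \<omega> f"
  shows "\<exists>D :: nat \<Rightarrow> 'a set set.
           (\<forall>m. cell_decomposition M (D m)) \<and> (\<forall>m. cellular M M (D (Suc m)) (D m) f)"
proof -
  have M: "compact_space M" "Hausdorff_space M"
    using assms(2) by (auto simp: closed_manifold_def topological_manifold_def)
  have "CPCF M f" using assms(5) by (simp add: Thurston_type_map_def)
  then obtain P P\<^sub>0 D\<^sub>0 B where "branched_cover M M f"
    and *: "cell_refinement (subtopology M (postcritical_set M f)) P\<^sub>0 P"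
      "cellular (subtopology M (postcritical_set M f)) (subtopology M (postcritical_set M f)) P\<^sub>0 P f"
      "cell_decomposition M D\<^sub>0" "P\<^sub>0 \<subseteq> D\<^sub>0"
      "cellular (subtopology M (branch_set M f)) (subtopology M (postcritical_set M f)) B P f"
      "\<forall>c\<in>B. \<forall>x\<in>cell_interior (subtopology M (branch_set M f)) c.
         \<forall>y\<in>cell_interior (subtopology M (branch_set M f)) c. local_index M f x = local_index M f y"
    unfolding CPCF_def Let_def by blast
  then interpret cpcf_map M f P P\<^sub>0 D\<^sub>0 B
    using M by unfold_locales blast+
  show ?thesis by (rule iterated_cell_lifts)
qed

end
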